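(* Let $a,b,r>0$ and let $g(u)=\frac{\exp(-bu)}{(1+\exp(-au))^r}$, $u\ge 0$. Let $\mathbf X\sim GML_n(\boldsymbol\mu,\mathbf\Sigma,g)$, with stochastic representation $\mathbf X=\boldsymbol\mu+\sqrt R\,\mathbf A'\mathbf U^{(n)}$. Let $\mathbf Y=\mathbf B\mathbf X+\mathbf b$, where $\mathbf B$ is an $m\times n$ real matrix with $1\le m<n$ and $\mathrm{rank}(\mathbf B)=m$, and $\mathbf b\in\mathbb R^m$. Then $\mathbf Y\sim Ell_m(\mathbf B\boldsymbol\mu+\mathbf b,\ \mathbf B\mathbf\Sigma\mathbf B',\ g_y)$ with $$g_y(t)=e^{-bt}a^{-\frac{n-m}{2}}\Gamma\left(\frac{n-m}{2}\right)\Phi^*_{r}\left(-e^{-at},\frac{n-m}{2},\frac ba\right),\quad t\ge0,$$ where $\Phi^*_r$ is the generalized Hurwitz-Lerch Zeta function. Moreover, $\mathbf Y$ admits the stochastic representation (equality in distribution) $$\mathbf Y=\boldsymbol\mu_Y+\sqrt{R_Y}\,\mathbf A_Y'\mathbf U^{(m)},$$ where $\boldsymbol\mu_Y=\mathbf B\boldsymbol\mu+\mathbf b$, $\mathbf A_Y$ is a square matrix with $\mathbf A_Y'\mathbf A_Y=\mathbf B\mathbf\Sigma\mathbf B'$, $\mathbf U^{(m)}$ is uniformly distributed on the unit sphere of $\mathbb R^m$ and independent of $R_Y$, and $R_Y=R\,W$, where $W$ is a nonnegative random variable independent of $R$ with distribution $Beta\left(\frac m2,\frac{n-m}{2}\r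ight)$.
   Context: A prime denotes transpose; $\boldsymbol\mu\in\mathbb R^n$ and $\mathbf\Sigma$ is a symmetric positive definite $n\times n$ matrix. $\mathbf Z\sim Ell_k(\boldsymbol\nu,\mathbf S,h)$ (elliptically symmetric distribution with location $\boldsymbol\nu\in\mathbb R^k$, symmetric positive definite scale matrix $\mathbf S$ and density generator $h\ge 0$) means that $\mathbf Z$ has density on $\mathbb R^k$ equal to $C|\mathbf S|^{-1/2}h\big((\mathbf z-\boldsymbol\nu)'\mathbf S^{-1}(\mathbf z-\boldsymbol\nu)\big)$, with $C>0$ the normalizing constant (so $h$ matters only up to a positive constant factor). For $a,b,r>0$ and $g(u)=\frac{\exp(-bu)}{(1+\exp(-au))^r}$, $\mathbf X\sim GML_n(\boldsymbol\mu,\mathbf\Sigma,g)$ (generalized elliptically symmetric logistic distribution) means $\mathbf X\sim Ell_n(\boldsymbol\mu,\mathbf\Sigma,g)$ for this $g$. Such an $\mathbf X$ admits the stochastic representation (in distribution) $\mathbf X=\boldsymbol\mu+\sqrt R\,\mathbf A'\mathbf U^{(n)}$, where $\mathbf A$ is a square matrix with $\mathbf A'\mathbf A=\mathbf\Sigma$, $\mathbf U^{(n)}$ is uniformly distributed on the unit sphere of $\mathbb R^n$, and $R\ge0$ is independent of $\mathbf U^{(n)}$ with pdf $f_R(v)=\frac{v^{n/2-1}g(v)}{\int_0^\infty t^{n/2-1}g(t)\,dt}$, $v\ge0$. The generalized Hurwitz-Lerch Zeta function is $$\Phi^*_{\mu}(z,s,\alpha)=\frac{1}{\Gamma(\mu)}\sum_{k=0}^{\infty}\frac{\Gamma(\mu+k)}{k!}\frac{z^k}{(k+\alpha)^s},$$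 with the integral representation $$\Phi^*_{\mu}(z,s,\alpha)=\frac{1}{\Gamma(s)}\int_0^{\infty}\frac{t^{s-1}e^{-\alpha t}}{(1-ze^{-t})^{\mu}}\,dt,$$ where $\mathrm{Re}(\alpha)>0$, and $\mathrm{Re}(s)>0$ when $|z|\le 1$, $z\ne 1$ ($\mathrm{Re}(s)>1$ when $z=1$). When the series does not converge (as can happen at $z=-1$), $\Phi^*_\mu$ is understood through the integral representation. *)

theory Defs
  imports "HOL-Probability.Probability"
begin

definition sym_pos_def :: "real^'k^'k \<Rightarrow> bool" where
  "sym_pos_def S \<longleftrightarrow> transpose S = S \<and> (\<forall>x. x \<noteq> 0 \<longrightarrow> 0 < x \<bullet> (S *v x))"

(* Z ~ Ell_k(nu, S, h) for a random vector Z on the probability space M.  Since M is a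
   probability space, C is forced to be the normalizing constant.  Non-negativity of h is
   stated explicitly because ennreal truncates negative values to 0. *)
definition elliptical ::
  "'a measure \<Rightarrow> ('a \<Rightarrow> real^'k) \<Rightarrow> real^'k \<Rightarrow> real^'k^'k \<Rightarrow> (real \<Rightarrow> real) \<Rightarrow> bool" where
  "elliptical M Z \<nu> S h \<longleftrightarrow>
     sym_pos_def S \<and> (\<forall>u\<ge>0. 0 \<le> h u) \<and>
     (\<exists>C>0. distributed M lborel Z
        (\<lambda>z. ennreal (C * det S powr (-1/2) * h ((z - \<nu>) \<bullet> (matrix_inv S *v (z - \<nu>))))))"

definition gml_generator :: "real \<Rightarrow> real \<Rightarrow> real \<Rightarrow> real \<Rightarrow> real" where
  "gml_generator a b r u = exp (- b * u) / (1 + exp (- a * u)) powr r"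

definition GML ::
  "'a measure \<Rightarrow> ('a \<Rightarrow> real^'n) \<Rightarrow> real^'n \<Rightarrow> real^'n^'n \<Rightarrow> real \<Rightarrow> real \<Rightarrow> real \<Rightarrow> bool" where
  "GML M X \<mu> \<Sigma> a b r \<longleftrightarrow> elliptical M X \<mu> \<Sigma> (gml_generator a b r)"

(* Generalized Hurwitz-Lerch Zeta function, for real or complex arguments.  It is the sum of
   the (possibly only conditionally convergent) series whenever that converges; otherwise it
   is given by the integral representation. *)
definition hurwitz_lerch ::
  "'a::{Gamma, ln, second_countable_topology} \<Rightarrow> 'a \<Rightarrow> 'a \<Rightarrow> 'a \<Rightarrow> 'a" where
  "hurwitz_lerch \<mu> z s \<alpha> =
     (let c = (\<lambda>k::nat. Gamma (\<mu> + of_nat k) / fact k * (z ^ k / (of_nat k + \<alpha>) powr s))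
      in if summable c then 1 / Gamma \<mu> * (\<Sum>k. c k)
         else 1 / Gamma s * (LBINT t:{0..}. of_real t powr (s - 1) * exp (- \<alpha> * of_real t)
                               / (1 - z * exp (- of_real t)) powr \<mu>))"

(* Normalized surface measure of the unit sphere: a Borel set E of the sphere gets the
   proportion of the volume of the unit ball occupied by the cone {t x | 0 < t \<le> 1, x \<in> E};
   recall sgn x = x / norm x. *)
definition uniform_sphere :: "(real^'k) measure" where
  "uniform_sphere = distr (uniform_measure lborel (cball 0 1)) borel sgn"

definition beta_density :: "real \<Rightarrow> real \<Rightarrow> real \<Rightarrow> real" where
  "beta_density p q x =
     (if 0 < x \<and> x < 1 then x powr (p - 1) * (1 - x) powr (q - 1) / Beta p q else 0)"

definition gml_radial_density :: "nat \<Rightarrow> real \<Rightarrow> real \<Rightarrow> real \<Rightarrow> real \<Rightarrow> real" where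
  "gml_radial_density n a b r v =
     (if 0 \<le> v
      then v powr (real n / 2 - 1) * gml_generator a b r v
             / (LBINT t:{0..}. t powr (real n / 2 - 1) * gml_generator a b r t)
      else 0)"

(* Independence of two random variables with possibly different value types; the library's
   indep_var, which it restates (cf. indep_var_eq), forces both to have the same type. *)
definition indep_rv ::
  "'a measure \<Rightarrow> 'b measure \<Rightarrow> ('a \<Rightarrow> 'b) \<Rightarrow> 'c measure \<Rightarrow> ('a \<Rightarrow> 'c) \<Rightarrow> bool" where
  "indep_rv M S X T Y \<longleftrightarrow>
     X \<in> measurable M S \<and> Y \<in> measurable M T \<and>
     prob_space.indep_set M
       (sigma_sets (space M) {X -` A \<inter> space M | A. A \<in> sets S})
       (sigma_sets (space M) {Y -` A \<inter> space M | A. A \<in> sets T})"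

(* Z = nu + sqrt R A' U in distribution, where A' A = S and R \<ge> 0 and U are independent random
   variables on the probability space N (unrelated to the space M of Z), U being uniform on
   the unit sphere. *)
definition stoch_rep ::
  "'a measure \<Rightarrow> ('a \<Rightarrow> real^'k) \<Rightarrow> real^'k \<Rightarrow> real^'k^'k \<Rightarrow>
   real^'k^'k \<Rightarrow> 'b measure \<Rightarrow> ('b \<Rightarrow> real) \<Rightarrow> ('b \<Rightarrow> real^'k) \<Rightarrow> bool" where
  "stoch_rep M Z \<nu> S A N R U \<longleftrightarrow>
     prob_space N \<and> transpose A ** A = S \<and> (\<forall>\<omega>\<in>space N. 0 \<le> R \<omega>) \<and>
     distr N borel U = uniform_sphere \<and> indep_rv N borel R borel U \<and>
     distr M borel Z = distr N borel (\<lambda>\<omega>. \<nu> + sqrt (R \<omega>) *\<^sub>R (transpose A *v U \<omega>))"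

definition gml_stoch_rep ::
  "'a measure \<Rightarrow> ('a \<Rightarrow> real^'n) \<Rightarrow> real^'n \<Rightarrow> real^'n^'n \<Rightarrow> real \<Rightarrow> real \<Rightarrow> real \<Rightarrow>
   real^'n^'n \<Rightarrow> 'b measure \<Rightarrow> ('b \<Rightarrow> real) \<Rightarrow> ('b \<Rightarrow> real^'n) \<Rightarrow> bool" where
  "gml_stoch_rep M X \<mu> \<Sigma> a b r A N R U \<longleftrightarrow>
     stoch_rep M X \<mu> \<Sigma> A N R U \<and>
     distributed N lborel R (\<lambda>v. ennreal (gml_radial_density CARD('n) a b r v))"

(* W is a nonnegative Beta(p, q) variable on N, independent of R. *)
definition indep_beta_factor ::
  "'b measure \<Rightarrow> ('b \<Rightarrow> real) \<Rightarrow> real \<Rightarrow> real \<Rightarrow> ('b \<Rightarrow> real) \<Rightarrow> bool" where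
  "indep_beta_factor N R p q W \<longleftrightarrow>
     (\<forall>\<omega>\<in>space N. 0 \<le> W \<omega>) \<and>
     distributed N lborel W (\<lambda>w. ennreal (beta_density p q w)) \<and>
     indep_rv N borel R borel W"

end

(*
  Write X = mu + A' V with A' A = Sigma and V of density proportional to g(|v|^2).  Choosing A_Y with
  A_Y' A_Y = B Sigma B', one has Y = B mu + c + A_Y' Q V for a matrix Q with orthonormal rows.  The map
  x |-> (Q x, |x|^2 - |Q x|^2) sends Lebesgue measure on R^n to Lebesgue measure on R^m times
  kappa u^((n-m)/2 - 1) du: the image is translation invariant in Q x, and scaling gives the power of u.
  Hence Y has generator t |-> integral of g(t + u) u^((n-m)/2 - 1) du, which the binomial series of
  (1 + exp(-a(t + u)))^(-r) turns into the Hurwitz-Lerch function.  The substitution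
  (t, u) = (v w, v (1 - w)) identifies t^(m/2 - 1) times this generator as the density of R W, and polar
  coordinates in R^m then give the stochastic representation.  Determinants never have to be computed:
  multiplicative constants are forced by total mass one.
*)
theory Submission
  imports Defs
begin

subsection \<open>Lebesgue measure, scaling and power weights\<close>

text \<open>The residual |x|^2 - |Q x|^2 is the squared length of the part of x orthogonal to the
  rows of Q. Recording only this number, and not that part itself, avoids completing Q to an
  orthogonal matrix, and translations and dilations are then the only symmetries to exploit. The
  obstacle is that the preimage of a box under Q alone has infinite volume; invariance is therefore
  applied with the residual bounded above, and the bound is removed afterwards by a monotone limit.

  At t = 0 the argument of the Hurwitz-Lerch function is -1, the geometric domination of the
  binomial series is lost, and either branch of the definition may apply. The density sees this at
  one point only, so the two forms of the generator are identified for t > 0 alone; nonnegativity,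
  however, is demanded at t = 0 too, and Abel summation supplies it where the series
  converges.\<close>

lemma nn_integral_lborel_translate:
  fixes f :: "'a::euclidean_space \<Rightarrow> ennreal"
  assumes [measurable]: "f \<in> borel_measurable borel"
  shows "(\<integral>\<^sup>+x. f (a + x) \<partial>lborel) = (\<integral>\<^sup>+x. f x \<partial>lborel)"
proof -
  have "(\<integral>\<^sup>+x. f x \<partial>lborel) = (\<integral>\<^sup>+x. f x \<partial>distr lborel borel ((+) a))"
    by (simp add: lborel_distr_plus)
  also have "\<dots> = (\<integral>\<^sup>+x. f (a + x) \<partial>lborel)"
    by (rule nn_integral_distr) auto
  finally show ?thesis by simp
qed

lemma nn_integral_lborel_reflect:
  fixes f :: "'a::euclidean_space \<Rightarrow> ennreal"
  assumes [measurable]: "f \<in> borel_measurable borel"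
  shows "(\<integral>\<^sup>+x. f (a - x) \<partial>lborel) = (\<integral>\<^sup>+x. f x \<partial>lborel)"
proof -
  have "(lborel :: 'a measure) = density (distr lborel borel (\<lambda>x. a - x)) (\<lambda>_. 1)"
    using lborel_affine[of "-1" a] by simp
  then have "(\<integral>\<^sup>+x. f x \<partial>lborel) = (\<integral>\<^sup>+x. f x \<partial>density (distr lborel borel (\<lambda>x. a - x)) (\<lambda>_. 1))"
    by (rule arg_cong)
  also have "\<dots> = (\<integral>\<^sup>+x. f (a - x) \<partial>lborel)"
    by (simp add: nn_integral_density nn_integral_distr)
  finally show ?thesis by simp
qed

text \<open>Uniqueness of Haar measure by Fubini. With \<open>g\<close> the indicator of the unit
  box, integrating \<open>f x * g (x + y)\<close> first over y gives
  \<open>emeasure \<mu> E\<close>; invariance of \<open>\<mu>\<close> lets x be shifted by -y, and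
  then the inner integral over y, reflected and translated, is \<open>emeasure lborel E\<close>. The
  constant is allowed to be infinite, so each use can settle its size later.\<close>

lemma translation_invariant_eq_lborel:
  fixes \<mu> :: "'a::euclidean_space measure"
  assumes "sigma_finite_measure \<mu>" and sets[measurable_cong]: "sets \<mu> = sets borel"
    and inv: "\<And>a. distr \<mu> borel ((+) a) = \<mu>"
  shows "\<mu> = density lborel (\<lambda>_. emeasure \<mu> (box 0 One))"
proof (rule measure_eqI)
  fix E assume E: "E \<in> sets \<mu>"
  interpret \<mu>: sigma_finite_measure \<mu> by fact
  interpret pair_sigma_finite \<mu> lborel
    by (simp add: pair_sigma_finite_def assms lborel.sigma_finite_measure_axioms)
  have [measurable]: "E \<in> sets borel" using E sets by simp
  define F :: "'a set" where "F = box 0 One"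
  have [measurable]: "F \<in> sets borel" by (simp add: F_def)
  define f g :: "'a \<Rightarrow> ennreal" where "f = indicator E" and "g = indicator F"
  have [measurable]: "f \<in> borel_measurable borel" "g \<in> borel_measurable borel"
    by (auto simp: f_def g_def)
  have F1: "emeasure lborel F = 1"
    by (simp add: F_def emeasure_lborel_box_eq)
  have shift: "(\<integral>\<^sup>+x. f x * g (x + y) \<partial>\<mu>) = (\<integral>\<^sup>+x. f (x - y) * g x \<partial>\<mu>)" for y
  proof -
    have "(\<integral>\<^sup>+x. f (x - y) * g x \<partial>\<mu>) = (\<integral>\<^sup>+x. f (x - y) * g x \<partial>distr \<mu> borel ((+) y))"
      by (simp add: inv)
    also have "\<dots> = (\<integral>\<^sup>+x. f (y + x - y) * g (y + x) \<partial>\<mu>)"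
      by (rule nn_integral_distr) auto
    finally show ?thesis by (simp add: add.commute)
  qed
  have "emeasure \<mu> E * emeasure lborel F = (\<integral>\<^sup>+x. f x * (\<integral>\<^sup>+y. g (x + y) \<partial>lborel) \<partial>\<mu>)"
    by (simp add: nn_integral_lborel_translate nn_integral_multc) (simp add: f_def g_def)
  also have "\<dots> = (\<integral>\<^sup>+x. \<integral>\<^sup>+y. f x * g (x + y) \<partial>lborel \<partial>\<mu>)"
    by (simp add: nn_integral_cmult)
  also have "\<dots> = (\<integral>\<^sup>+y. \<integral>\<^sup>+x. f x * g (x + y) \<partial>\<mu> \<partial>lborel)"
    by (rule Fubini'[symmetric]) measurable
  also have "\<dots> = (\<integral>\<^sup>+y. \<integral>\<^sup>+x. f (x - y) * g x \<partial>\<mu> \<partial>lborel)"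
    by (simp add: shift)
  also have "\<dots> = (\<integral>\<^sup>+x. \<integral>\<^sup>+y. f (x - y) * g x \<partial>lborel \<partial>\<mu>)"
    by (rule Fubini') measurable
  also have "\<dots> = (\<integral>\<^sup>+x. (\<integral>\<^sup>+y. f y \<partial>lborel) * g x \<partial>\<mu>)"
    by (simp add: nn_integral_multc nn_integral_lborel_reflect)
  also have "\<dots> = emeasure lborel E * emeasure \<mu> F"
    by (simp add: nn_integral_cmult) (simp add: f_def g_def sets)
  finally show "emeasure \<mu> E = emeasure (density lborel (\<lambda>_. emeasure \<mu> (box 0 One))) E"
    by (simp add: F1 emeasure_density nn_integral_cmult nn_integral_multc mult.commute F_def[symmetric])
qed (simp add: sets)

text \<open>The kernel of a Gamma-type density. The value 0 off the open half-line lets all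
  integrals run over the whole line, where translations and dilations do not move any
  limits.\<close>

definition power_weight :: "real \<Rightarrow> real \<Rightarrow> real" where
  "power_weight p v = (if 0 < v then v powr (p - 1) else 0)"

lemma power_weight_nonneg [simp]: "0 \<le> power_weight p v"
  by (simp add: power_weight_def)

lemma measurable_power_weight [measurable]: "power_weight p \<in> borel_measurable borel"
  unfolding power_weight_def [abs_def] by measurable

lemma nn_integral_power_weight_atMost:
  assumes p: "p > 0"
  shows "(\<integral>\<^sup>+v. ennreal (power_weight p v) * indicator {..\<rho>} v \<partial>lborel)
    = ennreal (if 0 < \<rho> then \<rho> powr p / p else 0)"
proof (cases "0 < \<rho>")
  case True
  have "((\<lambda>x. x powr (p - 1)) has_integral (\<rho> powr (p - 1 + 1) / (p - 1 + 1))) {0..\<rho>}"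
    using True p by (intro has_integral_powr_from_0) auto
  from nn_integral_has_integral_lebesgue[OF _ this]
  have "(\<integral>\<^sup>+v. ennreal (indicator {0..\<rho>} v * v powr (p - 1)) \<partial>lborel) = ennreal (\<rho> powr p / p)"
    using p by simp
  moreover have "(\<integral>\<^sup>+v. ennreal (power_weight p v) * indicator {..\<rho>} v \<partial>lborel)
     = (\<integral>\<^sup>+v. ennreal (indicator {0..\<rho>} v * v powr (p - 1)) \<partial>lborel)"
    by (intro nn_integral_cong) (auto simp: power_weight_def indicator_def)
  ultimately show ?thesis using True by simp
next
  case False
  have "(\<integral>\<^sup>+v. ennreal (power_weight p v) * indicator {..\<rho>} v \<partial>lborel) = (\<integral>\<^sup>+v. 0 \<partial>(lborel::real measure))"
    using False by (intro nn_integral_cong) (auto simp: power_weight_def indicator_def)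
  then show ?thesis using False by simp
qed

text \<open>Half-lines are an intersection-stable generator, and the factor \<open>p\<close> comes
  from differentiating \<open>\<rho> powr p\<close>. Only positive arguments are prescribed: since
  the prescribed values tend to 0 with \<rho>, the nonpositive half-line is null
  automatically.\<close>

lemma measure_eq_power_weight:
  fixes \<mu> :: "real measure"
  assumes p: "p > 0" and sets: "sets \<mu> = sets borel" and k: "0 \<le> k"
    and cum: "\<And>\<rho>. \<rho> > 0 \<Longrightarrow> emeasure \<mu> {..\<rho>} = ennreal (k * \<rho> powr p)"
  shows "\<mu> = density lborel (\<lambda>v. ennreal (k * p * power_weight p v))"
proof (rule measure_eqI_generator_eq[where E="range atMost" and A="\<lambda>n. {..real n}" and \<Omega>=UNIV])
  have all: "emeasure \<mu> {..\<rho>} = ennreal (if 0 < \<rho> then k * \<rho> powr p else 0)" for \<rho>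
  proof (cases "0 < \<rho>")
    case False
    have "emeasure \<mu> {..\<rho>} \<le> ennreal \<epsilon>" if "\<epsilon> > 0" for \<epsilon>
    proof -
      \<comment> \<open>Solves (k + 1) * \<delta>^p = \<epsilon>; the shift by 1 covers k =
        0.\<close>
      define \<delta> where "\<delta> = (\<epsilon> / (k + 1)) powr (1 / p)"
      have d: "\<delta> > 0" using that k by (auto simp: \<delta>_def)
      have "emeasure \<mu> {..\<rho>} \<le> emeasure \<mu> {..\<delta>}"
        using False d by (intro emeasure_mono) (auto simp: sets)
      also have "\<dots> = ennreal (k * \<delta> powr p)" using cum d by simp
      also have "k * \<delta> powr p = k / (k + 1) * \<epsilon>" using that k p by (simp add: \<delta>_def powr_powr)
      also have "k / (k + 1) * \<epsilon> \<le> \<epsilon>"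
        using that k by (simp add: field_simps)
      finally show ?thesis by (simp add: ennreal_leI)
    qed
    then have "emeasure \<mu> {..\<rho>} \<le> 0"
      by (intro ennreal_le_epsilon[where y=0]) simp
    then show ?thesis using False by simp
  qed (simp add: cum)
  show "Int_stable (range (atMost :: real \<Rightarrow> _))"
    by (auto simp: Int_stable_def)
  show "sets \<mu> = sigma_sets UNIV (range atMost)"
    by (subst sets) (simp add: borel_eq_atMost)
  show "sets (density lborel (\<lambda>v. ennreal (k * p * power_weight p v))) = sigma_sets UNIV (range atMost)"
    by (simp add: borel_eq_atMost)
  show "(\<Union>i. {..real i}) = UNIV"
    using real_arch_simple by auto
  show "emeasure \<mu> {..real i} \<noteq> \<infinity>" for i
    by (simp add: all)
  fix X :: "real set" assume "X \<in> range atMost"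
  then obtain \<rho> where X: "X = {..\<rho>}" by auto
  have "emeasure (density lborel (\<lambda>v. ennreal (k * p * power_weight p v))) X
    = (\<integral>\<^sup>+v. ennreal (k * p) * (ennreal (power_weight p v) * indicator {..\<rho>} v) \<partial>lborel)"
    using k p by (simp add: emeasure_density X ennreal_mult mult.assoc)
  also have "\<dots> = ennreal (k * p) * ennreal (if 0 < \<rho> then \<rho> powr p / p else 0)"
    by (subst nn_integral_cmult) (auto simp: nn_integral_power_weight_atMost[OF p])
  also have "\<dots> = ennreal (if 0 < \<rho> then k * \<rho> powr p else 0)"
    using k p by (auto simp flip: ennreal_mult)
  finally show "emeasure \<mu> X = emeasure (density lborel (\<lambda>v. ennreal (k * p * power_weight p v))) X"
    by (simp add: X all)
qed auto

lemma emeasure_lborel_scale: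
  fixes S :: "'a::euclidean_space set"
  assumes [measurable]: "S \<in> sets borel" and c: "c > 0"
  shows "emeasure lborel {x. (1 / c) *\<^sub>R x \<in> S} = ennreal (c ^ DIM('a)) * emeasure lborel S"
proof -
  have "emeasure lborel {x. (1 / c) *\<^sub>R x \<in> S}
     = emeasure (density (distr lborel borel (\<lambda>x. 0 + c *\<^sub>R x)) (\<lambda>_. \<bar>c\<bar>^DIM('a))) {x::'a. (1 / c) *\<^sub>R x \<in> S}"
    using c by (subst lborel_affine[of c 0]) auto
  also have "\<dots> = ennreal (c^DIM('a)) * emeasure lborel ((\<lambda>x. c *\<^sub>R x) -` {x::'a. (1 / c) *\<^sub>R x \<in> S})"
    using c by (simp add: emeasure_density nn_integral_cmult emeasure_distr)
  also have "(\<lambda>x. c *\<^sub>R x) -` {x::'a. (1 / c) *\<^sub>R x \<in> S} = S"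
    using c by auto
  finally show ?thesis .
qed

subsection \<open>Polar coordinates\<close>

lemma sets_uniform_sphere [simp, measurable_cong]: "sets uniform_sphere = sets borel"
  by (simp add: uniform_sphere_def)

lemma space_uniform_sphere [simp]: "space uniform_sphere = UNIV"
  by (simp add: uniform_sphere_def)

lemma emeasure_unit_cball:
  "0 < measure lborel (cball (0::'a::euclidean_space) 1)"
  "emeasure lborel (cball (0::'a) 1) = ennreal (measure lborel (cball (0::'a) 1))"
proof -
  show "0 < measure lborel (cball (0::'a) 1)"
    using content_cball_pos[of 1 "0::'a"] by simp
  show "emeasure lborel (cball (0::'a) 1) = ennreal (measure lborel (cball (0::'a) 1))"
    using emeasure_lborel_cball_finite[of "0::'a" 1] by (intro emeasure_eq_ennreal_measure) auto
qed

lemma prob_space_uniform_sphere: "prob_space (uniform_sphere :: (real^'k) measure)"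
  unfolding uniform_sphere_def
proof (rule prob_space.prob_space_distr)
  show "prob_space (uniform_measure lborel (cball (0::real^'k) 1))"
    using emeasure_unit_cball[where 'a="real^'k"] by (intro prob_space_uniform_measure) auto
qed (simp add: measurable_completion)

lemma emeasure_uniform_sphere:
  fixes E :: "(real^'k) set"
  assumes [measurable]: "E \<in> sets borel"
  shows "emeasure lborel {x \<in> cball 0 1. sgn x \<in> E}
    = ennreal (measure lborel (cball (0::real^'k) 1) * measure uniform_sphere E)"
proof -
  interpret U: prob_space "uniform_sphere :: (real^'k) measure" by (rule prob_space_uniform_sphere)
  let ?b = "measure lborel (cball (0::real^'k) 1)"
  have "emeasure uniform_sphere E = emeasure lborel {x \<in> cball 0 1. sgn x \<in> E} / ennreal ?b"
    unfolding uniform_sphere_def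
    by (subst emeasure_distr, simp, simp)
      (auto simp: emeasure_uniform_measure Int_def vimage_def emeasure_unit_cball(2)[symmetric]
        intro!: arg_cong[where f="emeasure lborel"] arg_cong2[where f="(/)"])
  then have "ennreal ?b * emeasure uniform_sphere E = emeasure lborel {x \<in> cball 0 1. sgn x \<in> E}"
    using emeasure_unit_cball(1)[where 'a="real^'k"]
      ennreal_mult_divide_eq[of "ennreal ?b" "emeasure lborel {x \<in> cball 0 1. sgn x \<in> E}"]
    by (simp add: ennreal_times_divide mult.commute)
  then show ?thesis by (simp add: U.emeasure_eq_measure ennreal_mult)
qed

lemma sigma_finite_density_real:
  fixes f :: "real \<Rightarrow> real"
  assumes [measurable]: "f \<in> borel_measurable borel"
  shows "sigma_finite_measure (density lborel (\<lambda>v. ennreal (f v)))"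
  by (subst sigma_finite_measure.sigma_finite_iff_density_finite'[OF sigma_finite_lborel]) auto

lemma sqrt_power_powr: "0 < x \<Longrightarrow> sqrt x ^ n = x powr (real n / 2)"
  by (simp add: powr_half_sqrt[symmetric] powr_realpow[symmetric] powr_powr)

text \<open>Directions in \<open>E\<close> and squared radius at most \<rho> cut out a truncated
  cone whose volume scales like sqrt \<rho> ^ k, k being the dimension; in squared radii this is the
  weight with exponent k/2. The constant is the volume of the unit ball times k/2, the second factor
  coming from differentiating \<rho>^(k/2). The origin, where \<open>sgn 0 = 0\<close>, is counted
  alike on both sides.\<close>

lemma polar_lborel:
  defines "\<kappa> \<equiv> measure lborel (cball (0::real^'k) 1) * (real CARD('k) / 2)"
  shows "distr lborel (borel \<Otimes>\<^sub>M borel) (\<lambda>x::real^'k. ((norm x)\<^sup>2, sgn x))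
    = density lborel (\<lambda>v. ennreal (\<kappa> * power_weight (real CARD('k) / 2) v)) \<Otimes>\<^sub>M uniform_sphere"
proof (rule pair_measure_eqI[symmetric])
  interpret U: prob_space "uniform_sphere :: (real^'k) measure" by (rule prob_space_uniform_sphere)
  show "sigma_finite_measure (density lborel (\<lambda>v. ennreal (\<kappa> * power_weight (real CARD('k) / 2) v)))"
    by (intro sigma_finite_density_real) measurable
  show "sigma_finite_measure (uniform_sphere :: (real^'k) measure)"
    by (rule U.sigma_finite_measure_axioms)
  fix A :: "real set" and E :: "(real^'k) set"
  assume "A \<in> sets (density lborel (\<lambda>v. ennreal (\<kappa> * power_weight (real CARD('k) / 2) v)))"
    and "E \<in> sets uniform_sphere"
  then have [measurable]: "A \<in> sets borel" "E \<in> sets borel" by auto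
  define p where "p = real CARD('k) / 2"
  have p: "p > 0" by (simp add: p_def)
  let ?b = "measure lborel (cball (0::real^'k) 1)"
  define \<mu> where "\<mu> = distr (density lborel (indicator {x::real^'k. sgn x \<in> E})) borel (\<lambda>x. (norm x)\<^sup>2)"
  have \<mu>: "emeasure \<mu> S = emeasure lborel {x::real^'k. (norm x)\<^sup>2 \<in> S \<and> sgn x \<in> E}"
    if [measurable]: "S \<in> sets borel" for S
  proof -
    have "emeasure \<mu> S = emeasure (density lborel (indicator {x::real^'k. sgn x \<in> E})) ((\<lambda>x. (norm x)\<^sup>2) -` S)"
      unfolding \<mu>_def by (subst emeasure_distr) (auto simp: vimage_def)
    also have "\<dots> = (\<integral>\<^sup>+x. indicator {x::real^'k. (norm x)\<^sup>2 \<in> S \<and> sgn x \<in> E} x \<partial>lborel)"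
      using measurable_sets[of "\<lambda>x::real^'k. (norm x)\<^sup>2" borel borel S]
      by (subst emeasure_density, simp, simp, intro nn_integral_cong) (simp split: split_indicator)
    also have "\<dots> = emeasure lborel {x::real^'k. (norm x)\<^sup>2 \<in> S \<and> sgn x \<in> E}"
      by (rule nn_integral_indicator) simp
    finally show ?thesis .
  qed
  have "\<mu> = density lborel (\<lambda>v. ennreal (?b * measure uniform_sphere E * p * power_weight p v))"
  proof (rule measure_eq_power_weight[OF p])
    show "sets \<mu> = sets borel" by (simp add: \<mu>_def)
    fix \<rho> :: real assume \<rho>: "\<rho> > 0"
    have "{x::real^'k. (norm x)\<^sup>2 \<in> {..\<rho>} \<and> sgn x \<in> E}
        = {x. (1 / sqrt \<rho>) *\<^sub>R x \<in> {x \<in> cball 0 1. sgn x \<in> E}}"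
      using \<rho> by (auto simp: sgn_scaleR divide_le_eq real_le_rsqrt real_sqrt_ge_zero
          dest: real_le_rsqrt simp flip: real_sqrt_le_iff[of "(norm _)\<^sup>2"])
    then have "emeasure \<mu> {..\<rho>} = emeasure lborel {x. (1 / sqrt \<rho>) *\<^sub>R x \<in> {x \<in> cball 0 1. sgn x \<in> E}}"
      by (simp add: \<mu>)
    also have "\<dots> = ennreal (sqrt \<rho> ^ DIM(real^'k)) * emeasure lborel {x \<in> cball 0 1. sgn x \<in> E}"
      using \<rho> by (intro emeasure_lborel_scale) auto
    also have "\<dots> = ennreal (?b * measure uniform_sphere E * \<rho> powr p)"
      using \<rho> by (subst emeasure_uniform_sphere)
        (simp_all add: sqrt_power_powr p_def ennreal_mult mult_ac)
    finally show "emeasure \<mu> {..\<rho>} = ennreal (?b * measure uniform_sphere E * \<rho> powr p)" .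
  qed simp
  then have "emeasure \<mu> A
      = (\<integral>\<^sup>+v. ennreal (?b * measure uniform_sphere E * p * power_weight p v) * indicator A v \<partial>lborel)"
    by (simp add: emeasure_density)
  also have "\<dots> = (\<integral>\<^sup>+v. emeasure uniform_sphere E * (ennreal (\<kappa> * power_weight p v) * indicator A v) \<partial>lborel)"
  proof (rule nn_integral_cong)
    fix v
    have "?b * measure uniform_sphere E * p * power_weight p v
        = measure uniform_sphere E * (\<kappa> * power_weight p v)"
      by (simp add: \<kappa>_def p_def)
    then show "ennreal (?b * measure uniform_sphere E * p * power_weight p v) * indicator A v
        = emeasure uniform_sphere E * (ennreal (\<kappa> * power_weight p v) * indicator A v)"
      by (simp only: U.emeasure_eq_measure ennreal_mult'[OF measure_nonneg] mult.assoc)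
  qed
  also have "\<dots> = emeasure (density lborel (\<lambda>v. ennreal (\<kappa> * power_weight p v))) A * emeasure uniform_sphere E"
    by (subst nn_integral_cmult) (auto simp: emeasure_density mult.commute)
  finally show "emeasure (density lborel (\<lambda>v. ennreal (\<kappa> * power_weight (real CARD('k) / 2) v))) A * emeasure uniform_sphere E
     = emeasure (distr lborel (borel \<Otimes>\<^sub>M borel) (\<lambda>x::real^'k. ((norm x)\<^sup>2, sgn x))) (A \<times> E)"
    by (subst emeasure_distr) (auto simp: \<mu> p_def vimage_def)
qed (simp cong: sets_pair_measure_cong)

lemma emeasure_lborel_open_pos:
  fixes S :: "'a::euclidean_space set"
  assumes "open S" "S \<noteq> {}"
  shows "0 < emeasure lborel S"
proof -
  obtain x e where e: "e > 0" "ball x e \<subseteq> S"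
    using assms by (metis ex_in_conv openE)
  have "0 < emeasure lborel (ball x e)"
    using content_ball_pos[OF e(1), of x] by (simp add: measure_def zero_less_iff_neq_zero enn2real_positive_iff)
  also have "\<dots> \<le> emeasure lborel S"
    using e assms by (intro emeasure_mono) auto
  finally show ?thesis .
qed

lemma measurable_matrix_vector [measurable (raw)]:
  fixes B :: "real^'n^'m"
  assumes "f \<in> borel_measurable M"
  shows "(\<lambda>x. B *v f x) \<in> borel_measurable M"
proof -
  have "(*v) B \<in> borel_measurable borel"
    by (intro borel_measurable_continuous_onI linear_continuous_on linear_linear[THEN iffD2] matrix_vector_mul_linear)
  then show ?thesis using assms by measurable
qed

text \<open>\<open>transpose Q\<close> embeds the target isometrically as the row space. The last
  claim is the reason for taking |x|^2 - |Q x|^2 as second coordinate: it is the squared distance of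
  x from that subspace, hence unchanged by moving along it, while Q x can thereby be moved
  anywhere.\<close>

lemma orthonormal_rows:
  fixes Q :: "real^'n^'m"
  assumes "Q ** transpose Q = mat 1"
  shows "Q *v (transpose Q *v y) = y" "norm (transpose Q *v y) = norm y"
    "(norm (x + transpose Q *v y))\<^sup>2 - (norm (Q *v (x + transpose Q *v y)))\<^sup>2 = (norm x)\<^sup>2 - (norm (Q *v x))\<^sup>2"
proof -
  show 1: "Q *v (transpose Q *v y) = y" for y
    by (simp add: matrix_vector_mul_assoc assms del: transpose_matrix_vector)
  have ip: "x \<bullet> (transpose Q *v y) = (Q *v x) \<bullet> y" for x y
    by (metis dot_lmul_matrix inner_commute transpose_matrix_vector)
  show "norm (transpose Q *v y) = norm y"
    by (simp add: norm_eq_sqrt_inner ip 1 del: transpose_matrix_vector)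
  show "(norm (x + transpose Q *v y))\<^sup>2 - (norm (Q *v (x + transpose Q *v y)))\<^sup>2 = (norm x)\<^sup>2 - (norm (Q *v x))\<^sup>2"
    by (simp add: power2_norm_eq_inner matrix_vector_right_distrib inner_add_left inner_add_right ip 1 inner_commute
        del: transpose_matrix_vector)
qed

subsection \<open>Orthogonal projections and affine maps\<close>

lemma emeasure_projection_finite:
  fixes Q :: "real^'n^'m"
  assumes "bounded E"
  shows "emeasure lborel {x. Q *v x \<in> E \<and> (norm x)\<^sup>2 - (norm (Q *v x))\<^sup>2 \<in> {..\<rho>}} < \<infinity>"
proof -
  obtain K where K: "\<And>y. y \<in> E \<Longrightarrow> norm y \<le> K"
    using assms by (auto simp: bounded_iff)
  have "bounded {x. Q *v x \<in> E \<and> (norm x)\<^sup>2 - (norm (Q *v x))\<^sup>2 \<in> {..\<rho>}}"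
    unfolding bounded_iff
  proof (intro exI[of _ "sqrt (\<rho> + K\<^sup>2)"] ballI)
    fix x assume "x \<in> {x. Q *v x \<in> E \<and> (norm x)\<^sup>2 - (norm (Q *v x))\<^sup>2 \<in> {..\<rho>}}"
    then have "(norm x)\<^sup>2 \<le> \<rho> + (norm (Q *v x))\<^sup>2" "norm (Q *v x) \<le> K"
      using K by auto
    then have "(norm x)\<^sup>2 \<le> \<rho> + K\<^sup>2"
      using power_mono[of "norm (Q *v x)" K 2] by simp
    then show "norm x \<le> sqrt (\<rho> + K\<^sup>2)" by (rule real_le_rsqrt)
  qed
  then show ?thesis by (rule emeasure_bounded_finite)
qed

text \<open>With \<open>A\<close> fixed, the left side as a function of \<open>E\<close> is
  translation invariant, hence a multiple of Lebesgue measure, and the multiple is read off on the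
  unit box. The bound on \<open>A\<close> provides sigma-finiteness: it makes the preimages of balls
  bounded.\<close>

lemma emeasure_projection_product:
  fixes Q :: "real^'n^'m" and E :: "(real^'m) set" and A :: "real set"
  assumes Q: "Q ** transpose Q = mat 1"
    and E[measurable]: "E \<in> sets borel" and A: "A \<in> sets borel" "A \<subseteq> {..\<rho>}"
  shows "emeasure lborel {x. Q *v x \<in> E \<and> (norm x)\<^sup>2 - (norm (Q *v x))\<^sup>2 \<in> A}
    = emeasure lborel E
      * emeasure lborel {x. Q *v x \<in> box 0 One \<and> (norm x)\<^sup>2 - (norm (Q *v x))\<^sup>2 \<in> A}"
proof -
  have [measurable]: "A \<in> sets borel" by fact
  define q where "q x = (norm x)\<^sup>2 - (norm (Q *v x))\<^sup>2" for x
  have [measurable]: "q \<in> borel_measurable borel" unfolding q_def by measurable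
  define \<mu> where "\<mu> = distr (density lborel (indicator {x. q x \<in> A})) borel ((*v) Q)"
  have [measurable]: "(*v) Q \<in> borel_measurable borel" by measurable
  have \<mu>: "emeasure \<mu> S = emeasure lborel {x. Q *v x \<in> S \<and> q x \<in> A}"
    if [measurable]: "S \<in> sets borel" for S
  proof -
    have "emeasure \<mu> S = emeasure (density lborel (indicator {x. q x \<in> A})) {x. Q *v x \<in> S}"
      unfolding \<mu>_def by (subst emeasure_distr) (auto simp: vimage_def)
    also have "\<dots> = (\<integral>\<^sup>+x. indicator {x. Q *v x \<in> S \<and> q x \<in> A} x \<partial>lborel)"
      by (subst emeasure_density, simp, simp, intro nn_integral_cong) (simp split: split_indicator)
    also have "\<dots> = emeasure lborel {x. Q *v x \<in> S \<and> q x \<in> A}"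
      by (rule nn_integral_indicator) simp
    finally show ?thesis .
  qed
  have "\<mu> = density lborel (\<lambda>_. emeasure \<mu> (box 0 One))"
  proof (rule translation_invariant_eq_lborel)
    show sets: "sets \<mu> = sets borel" by (simp add: \<mu>_def)
    show "sigma_finite_measure \<mu>"
    proof (rule sigma_finite_measure.intro, intro exI[of _ "range (\<lambda>n::nat. cball 0 (real n))"] conjI)
      show "\<Union> (range (\<lambda>n. cball 0 (real n))) = space \<mu>"
        by (auto simp: \<mu>_def real_arch_simple)
      show "\<forall>a\<in>range (\<lambda>n. cball 0 (real n)). emeasure \<mu> a \<noteq> \<infinity>"
      proof safe
        fix n :: nat assume *: "emeasure \<mu> (cball 0 (real n)) = \<infinity>"
        have "emeasure \<mu> (cball 0 (real n)) \<le> emeasure lborel {x. Q *v x \<in> cball 0 (real n) \<and> q x \<in> {..\<rho>}}"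
          using A by (subst \<mu>) (auto intro!: emeasure_mono)
        also have "\<dots> < \<infinity>" unfolding q_def by (rule emeasure_projection_finite) simp
        finally show False using * by simp
      qed
    qed (auto simp: sets)
    fix a :: "real^'m"
    show "distr \<mu> borel ((+) a) = \<mu>"
    proof (rule measure_eqI)
      fix S assume "S \<in> sets (distr \<mu> borel ((+) a))"
      then have [measurable]: "S \<in> sets borel" by simp
      have [measurable]: "(+) a \<in> borel_measurable borel" by measurable
      have "emeasure (distr \<mu> borel ((+) a)) S = emeasure \<mu> {y. a + y \<in> S}"
        by (subst emeasure_distr) (auto simp: \<mu>_def vimage_def)
      also have "\<dots> = emeasure lborel {x. Q *v x + a \<in> S \<and> q x \<in> A}"
        by (subst \<mu>) (auto simp: add.commute)
      \<comment> \<open>Translating the image by \<open>a\<close> lifts to translating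
        \<open>x\<close> along the row space, which preserves the residual and Lebesgue measure on
        the source.\<close>
      also have "{x. Q *v x + a \<in> S \<and> q x \<in> A}
        = (\<lambda>x. transpose Q *v a + x) -` {x. Q *v x \<in> S \<and> q x \<in> A}"
        using orthonormal_rows[OF Q]
        by (auto simp: q_def matrix_vector_right_distrib add.commute simp del: transpose_matrix_vector)
      also have "emeasure lborel \<dots> = emeasure (distr lborel borel ((+) (transpose Q *v a))) {x. Q *v x \<in> S \<and> q x \<in> A}"
        by (subst emeasure_distr) auto
      also have "\<dots> = emeasure \<mu> S"
        by (simp add: lborel_distr_plus \<mu>)
      finally show "emeasure (distr \<mu> borel ((+) a)) S = emeasure \<mu> S" .
    qed (simp add: sets)
  qed
  then have "emeasure \<mu> E = emeasure (density lborel (\<lambda>_. emeasure \<mu> (box 0 One))) E" by simp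
  also have "\<dots> = emeasure \<mu> (box 0 One) * emeasure lborel E"
    by (rule emeasure_density_const) simp
  finally show ?thesis
    by (simp add: \<mu> q_def mult.commute)
qed

text \<open>The exponent comes from a dilation by sqrt \<rho>: it multiplies volumes by \<rho>^(n/2)
  in the source and by \<rho>^(m/2) in the base, leaving \<rho>^((n-m)/2) for the residual. The
  strict inequality of the dimensions makes this exponent positive.\<close>

lemma projection_lborel:
  fixes Q :: "real^'n^'m"
  assumes Q: "Q ** transpose Q = mat 1" and less: "CARD('m) < CARD('n)"
  obtains \<kappa> where "0 < \<kappa>"
    "distr lborel (borel \<Otimes>\<^sub>M borel) (\<lambda>x. (Q *v x, (norm x)\<^sup>2 - (norm (Q *v x))\<^sup>2))
     = lborel \<Otimes>\<^sub>M density lborel (\<lambda>v. ennreal (\<kappa> * power_weight (real (CARD('n) - CARD('m)) / 2) v))"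
proof -
  define p where "p = real (CARD('n) - CARD('m)) / 2"
  have p: "p > 0" using less by (simp add: p_def)
  define q where "q x = (norm x)\<^sup>2 - (norm (Q *v x))\<^sup>2" for x
  have [measurable]: "q \<in> borel_measurable borel" unfolding q_def by measurable
  define F :: "(real^'m) set" where "F = box 0 One"
  have [measurable]: "F \<in> sets borel" by (simp add: F_def)
  define c where "c A = emeasure lborel {x. Q *v x \<in> F \<and> q x \<in> A}" for A
  have prod: "emeasure lborel {x. Q *v x \<in> E \<and> q x \<in> A} = emeasure lborel E * c A"
    if "E \<in> sets borel" "A \<in> sets borel" "A \<subseteq> {..\<rho>}" for E A \<rho>
    using emeasure_projection_product[OF Q that] by (simp add: q_def c_def F_def)
  have fin: "c {..\<rho>} < \<infinity>" for \<rho>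
    unfolding c_def q_def F_def by (rule emeasure_projection_finite) (rule bounded_box)
  have scale: "c {..\<rho>} = ennreal (\<rho> powr p) * c {..1}" if \<rho>: "\<rho> > 0" for \<rho>
  proof -
    let ?r = "sqrt \<rho>"
    have r: "?r > 0" using \<rho> by simp
    have q_scale: "q ((1 / ?r) *\<^sub>R x) = q x / \<rho>" for x
      using \<rho> by (simp add: q_def matrix_vector_mult_scaleR power_divide diff_divide_distrib)
    have "emeasure lborel {x. (1 / ?r) *\<^sub>R x \<in> {x. Q *v x \<in> F \<and> q x \<in> {..1}}}
      = ennreal (?r ^ DIM(real^'n)) * c {..1}"
      unfolding c_def using r by (intro emeasure_lborel_scale) auto
    moreover have "{x. (1 / ?r) *\<^sub>R x \<in> {x. Q *v x \<in> F \<and> q x \<in> {..1}}}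
      = {x. Q *v x \<in> {y. (1 / ?r) *\<^sub>R y \<in> F} \<and> q x \<in> {..\<rho>}}"
      using \<rho> q_scale by (auto simp: matrix_vector_mult_scaleR divide_le_eq)
    moreover have "emeasure lborel {x. Q *v x \<in> {y. (1 / ?r) *\<^sub>R y \<in> F} \<and> q x \<in> {..\<rho>}}
      = emeasure lborel {y. (1 / ?r) *\<^sub>R y \<in> F} * c {..\<rho>}"
      by (rule prod) auto
    moreover have "emeasure lborel {y. (1 / ?r) *\<^sub>R y \<in> F} = ennreal (?r ^ DIM(real^'m))"
      using r by (subst emeasure_lborel_scale) (auto simp: F_def emeasure_lborel_box_eq)
    ultimately have eq: "ennreal (?r ^ CARD('m)) * c {..\<rho>} = ennreal (?r ^ CARD('n)) * c {..1}"
      by simp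
    have "?r ^ CARD('n) = ?r ^ CARD('m) * \<rho> powr p"
      using \<rho> less by (simp add: sqrt_power_powr p_def of_nat_diff diff_divide_distrib flip: powr_add)
    then have "ennreal (?r ^ CARD('m)) * c {..\<rho>} = ennreal (?r ^ CARD('m)) * (ennreal (\<rho> powr p) * c {..1})"
      using eq r by (simp add: ennreal_mult mult.assoc)
    then show ?thesis using r by (simp add: ennreal_mult_cancel_left)
  qed
  define k where "k = enn2real (c {..1})"
  have ck: "c {..1} = ennreal k" using fin[of 1] by (simp add: k_def)
  have k: "k > 0"
  proof -
    have "0 < emeasure lborel {x. Q *v x \<in> F \<and> q x < 1}"
    proof (rule emeasure_lborel_open_pos)
      have "open ((\<lambda>x. Q *v x) -` F)"
        unfolding F_def by (intro open_vimage continuous_intros open_box)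
      moreover have "open {x. q x < 1}"
        unfolding q_def by (intro open_Collect_less continuous_intros)
      ultimately show "open {x. Q *v x \<in> F \<and> q x < 1}"
        using open_Int by (fastforce simp: Int_def vimage_def)
      \<comment> \<open>The centre of the box, lifted to the row space, has residual 0 and so
        satisfies the strict bound; the open set is nonempty and the constant positive.\<close>
      have "transpose Q *v ((1/2) *\<^sub>R One) \<in> {x. Q *v x \<in> F \<and> q x < 1}"
        using orthonormal_rows[OF Q] by (auto simp: q_def F_def mem_box simp del: transpose_matrix_vector)
      then show "{x. Q *v x \<in> F \<and> q x < 1} \<noteq> {}" by blast
    qed
    also have "\<dots> \<le> c {..1}" unfolding c_def by (intro emeasure_mono) auto
    finally show ?thesis by (simp add: ck)
  qed
  define D where "D = distr lborel (borel \<Otimes>\<^sub>M borel) (\<lambda>x. (Q *v x, q x))"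
  define R where "R = density lborel (\<lambda>v. ennreal (k * p * power_weight p v))"
  have sR: "sets R = sets borel" by (simp add: R_def)
  have R: "distr (density lborel (indicator {x. Q *v x \<in> F})) borel q = R"
    unfolding R_def
  proof (rule measure_eq_power_weight[OF p])
    fix \<rho> :: real assume \<rho>: "\<rho> > 0"
    have "emeasure (distr (density lborel (indicator {x. Q *v x \<in> F})) borel q) {..\<rho>}
      = (\<integral>\<^sup>+x. indicator {x. Q *v x \<in> F \<and> q x \<in> {..\<rho>}} x \<partial>lborel)"
      by (subst emeasure_distr, simp, simp, subst emeasure_density, simp,
        (use measurable_sets[of q borel borel "{..\<rho>}"] in simp), intro nn_integral_cong) (simp split: split_indicator)
    also have "\<dots> = c {..\<rho>}" unfolding c_def by (rule nn_integral_indicator) simp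
    also have "\<dots> = ennreal (k * \<rho> powr p)"
      using k by (simp add: scale[OF \<rho>] ck mult.commute flip: ennreal_mult)
    finally show "emeasure (distr (density lborel (indicator {x. Q *v x \<in> F})) borel q) {..\<rho>} = ennreal (k * \<rho> powr p)" .
  qed (use k in auto)
  have cR: "c A = emeasure R A" if [measurable]: "A \<in> sets borel" for A
  proof -
    have "emeasure R A = (\<integral>\<^sup>+x. indicator {x. Q *v x \<in> F \<and> q x \<in> A} x \<partial>lborel)"
      unfolding R[symmetric]
      by (subst emeasure_distr, simp, simp, subst emeasure_density, simp,
        (use measurable_sets[of q borel borel A] in simp), intro nn_integral_cong) (simp split: split_indicator)
    also have "\<dots> = c A" unfolding c_def by (rule nn_integral_indicator) simp
    finally show ?thesis by simp
  qed
  have "D = lborel \<Otimes>\<^sub>M R"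
  proof (rule pair_measure_eqI[symmetric])
    show "sigma_finite_measure (lborel :: (real^'m) measure)" by (rule sigma_finite_lborel)
    show "sigma_finite_measure R" unfolding R_def by (intro sigma_finite_density_real) measurable
    show "sets (lborel \<Otimes>\<^sub>M R) = sets D" by (simp add: D_def sR cong: sets_pair_measure_cong)
    fix E :: "(real^'m) set" and A assume "E \<in> sets lborel" "A \<in> sets R"
    then have [measurable]: "E \<in> sets borel" "A \<in> sets borel" by (auto simp: sR)
    \<comment> \<open>The product formula is available only for residuals bounded above;
      \<open>A\<close> is exhausted by such pieces and the supremum taken.\<close>
    have A: "A = (\<Union>n::nat. A \<inter> {..real n})"
      using real_arch_simple by auto
    have "emeasure R A = (SUP n::nat. emeasure R (A \<inter> {..real n}))"
      by (subst A, rule SUP_emeasure_incseq[symmetric]) (auto simp: incseq_def sR)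
    then have "emeasure lborel E * emeasure R A = (SUP n::nat. emeasure lborel E * c (A \<inter> {..real n}))"
      by (simp add: cR SUP_mult_left_ennreal)
    also have "\<dots> = (SUP n::nat. emeasure lborel {x. Q *v x \<in> E \<and> q x \<in> A \<inter> {..real n}})"
    proof (rule SUP_cong[OF refl])
      fix n :: nat
      show "emeasure lborel E * c (A \<inter> {..real n}) = emeasure lborel {x. Q *v x \<in> E \<and> q x \<in> A \<inter> {..real n}}"
        by (rule prod[symmetric, where \<rho>="real n"]) auto
    qed
    also have "\<dots> = emeasure lborel (\<Union>n::nat. {x. Q *v x \<in> E \<and> q x \<in> A \<inter> {..real n}})"
      by (rule SUP_emeasure_incseq) (auto simp: incseq_def)
    also have "(\<Union>n::nat. {x. Q *v x \<in> E \<and> q x \<in> A \<inter> {..real n}}) = {x. Q *v x \<in> E \<and> q x \<in> A}"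
      using real_arch_simple by auto
    also have "emeasure lborel \<dots> = emeasure D (E \<times> A)"
      unfolding D_def by (subst emeasure_distr) (auto simp: vimage_def)
    finally show "emeasure lborel E * emeasure R A = emeasure D (E \<times> A)" .
  qed
  then show ?thesis
    using that[of "k * p"] k p by (simp add: D_def R_def q_def p_def)
qed

text \<open>A shift of the image by a comes from a shift of the source by \<open>A' *v a\<close>,
  with \<open>A'\<close> the inverse, so the image measure is translation invariant. The constant is
  the volume of the preimage of the unit box, that is 1/|det A|: positive because this preimage is
  open and nonempty, finite because it is bounded.\<close>

lemma affine_lborel:
  fixes A :: "real^'k^'k"
  assumes A: "invertible A"
  obtains c where "0 < c" "distr lborel borel (\<lambda>x. \<nu> + A *v x) = density lborel (\<lambda>_. ennreal c)"
proof -
  define T where "T x = \<nu> + A *v x" for x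
  have [measurable]: "T \<in> borel_measurable borel" unfolding T_def by measurable
  define \<mu> where "\<mu> = distr lborel borel T"
  obtain A' where A': "A ** A' = mat 1" "A' ** A = mat 1"
    using A by (auto simp: invertible_def)
  have T_inv: "T x = y \<longleftrightarrow> x = A' *v (y - \<nu>)" for x y
    using A' by (auto simp: T_def matrix_vector_mul_assoc)
  have T_vimage: "T -` S = (\<lambda>y. A' *v (y - \<nu>)) ` S" for S
    using T_inv by (auto simp: image_iff)
  have \<mu>: "emeasure \<mu> S = emeasure lborel (T -` S)" if "S \<in> sets borel" for S
    using that by (simp add: \<mu>_def emeasure_distr)
  have fin: "emeasure \<mu> S < \<infinity>" if "bounded S" "S \<in> sets borel" for S
  proof -
    have "bounded ((\<lambda>y. y - \<nu>) ` S)"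
      using bounded_translation_minus[OF that(1)] by simp
    then have "bounded ((*v) A' ` ((\<lambda>y. y - \<nu>) ` S))"
      by (rule bounded_linear_image) (simp add: linear_linear)
    then have "bounded (T -` S)" by (simp add: T_vimage image_image)
    then show ?thesis using that emeasure_bounded_finite by (simp add: \<mu>)
  qed
  have "\<mu> = density lborel (\<lambda>_. emeasure \<mu> (box 0 One))"
  proof (rule translation_invariant_eq_lborel)
    show sets: "sets \<mu> = sets borel" by (simp add: \<mu>_def)
    show "sigma_finite_measure \<mu>"
    proof (rule sigma_finite_measure.intro, intro exI[of _ "range (\<lambda>n::nat. cball 0 (real n))"] conjI)
      show "\<Union> (range (\<lambda>n. cball 0 (real n))) = space \<mu>"
        by (auto simp: \<mu>_def real_arch_simple)
      show "\<forall>a\<in>range (\<lambda>n. cball 0 (real n)). emeasure \<mu> a \<noteq> \<infinity>"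
        using fin[OF bounded_cball] by (auto simp: less_top)
    qed (auto simp: sets)
    fix a
    have "distr \<mu> borel ((+) a) = distr lborel borel (T \<circ> (+) (A' *v a))"
      unfolding \<mu>_def using A'
      by (subst distr_distr) (auto simp: T_def matrix_vector_right_distrib matrix_vector_mul_assoc algebra_simps
          intro!: distr_cong)
    also have "\<dots> = \<mu>"
      unfolding \<mu>_def by (subst distr_distr[where N=borel, symmetric]) (auto simp: lborel_distr_plus)
    finally show "distr \<mu> borel ((+) a) = \<mu>" .
  qed
  moreover have "emeasure \<mu> (box 0 One) > 0"
  proof (subst \<mu>)
    show "0 < emeasure lborel (T -` box 0 One)"
    proof (rule emeasure_lborel_open_pos)
      show "open (T -` box 0 One)"
        unfolding T_def by (intro open_vimage continuous_intros open_box)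
      show "T -` box 0 One \<noteq> {}"
        unfolding T_vimage by (simp add: box_eq_empty)
    qed
  qed simp
  moreover have "emeasure \<mu> (box 0 One) < \<infinity>"
    by (intro fin bounded_box) simp
  moreover define c where "c = enn2real (emeasure \<mu> (box 0 One))"
  ultimately have "\<mu> = density lborel (\<lambda>_. ennreal c)" "0 < c"
    by (simp_all add: enn2real_positive_iff)
  then show ?thesis
    using that[of c] by (simp add: \<mu>_def T_def[abs_def])
qed

lemma matrix_inv_inverse:
  fixes A :: "'a::semiring_1^'n^'n"
  assumes "invertible A"
  shows "A ** matrix_inv A = mat 1" "matrix_inv A ** A = mat 1"
  using assms unfolding invertible_def matrix_inv_def
  by (metis (mono_tags, lifting) someI_ex)+

lemma affine_density:
  fixes A :: "real^'k^'k"
  assumes A: "invertible A"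
  obtains c where "0 < c"
    "\<And>f. f \<in> borel_measurable borel \<Longrightarrow> distr (density lborel f) borel (\<lambda>x. \<nu> + A *v x)
      = density lborel (\<lambda>z. ennreal c * f (matrix_inv A *v (z - \<nu>)))"
proof -
  obtain c where c: "0 < c" "distr lborel borel (\<lambda>x. \<nu> + A *v x) = density lborel (\<lambda>_. ennreal c)"
    using affine_lborel[OF A] .
  have "distr (density lborel f) borel (\<lambda>x. \<nu> + A *v x)
      = density lborel (\<lambda>z. ennreal c * f (matrix_inv A *v (z - \<nu>)))"
    if [measurable]: "f \<in> borel_measurable borel" for f
  proof -
    have inv: "matrix_inv A *v (\<nu> + A *v x - \<nu>) = x" for x
      using matrix_inv_inverse[OF A] by (simp add: matrix_vector_mul_assoc)
    then have inv': "matrix_inv A *v (A *v x) = x" for x by simp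
    have "density (distr lborel borel (\<lambda>x. \<nu> + A *v x)) (\<lambda>z. f (matrix_inv A *v (z - \<nu>)))
       = distr (density lborel f) borel (\<lambda>x. \<nu> + A *v x)"
      by (subst density_distr) (auto simp: inv')
    then show ?thesis unfolding c(2) by (simp add: density_density_eq)
  qed
  then show ?thesis using c(1) that by blast
qed

subsection \<open>Positive definite matrices and independence\<close>

text \<open>Gram-Schmidt for the inner product \<open>x \<bullet> (S *v y)\<close>. While
  \<open>J\<close> misses an index, there are fewer vectors \<open>S *v b j\<close> than the
  dimension, so some nonzero x is orthogonal to all of them; symmetry of S gives orthogonality in
  the other slot. Indexing by the coordinate type makes the full family the columns of a square
  matrix.\<close>

lemma sym_pos_def_orthonormal:
  fixes S :: "real^'k^'k"
  assumes S: "sym_pos_def S" and "finite J"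
  shows "\<exists>b::'k \<Rightarrow> real^'k. \<forall>i\<in>J. \<forall>j\<in>J. b i \<bullet> (S *v b j) = (if i = j then 1 else 0)"
  using \<open>finite J\<close>
proof (induction J)
  case (insert l J)
  then obtain b :: "'k \<Rightarrow> real^'k"
    where b: "\<And>i j. i \<in> J \<Longrightarrow> j \<in> J \<Longrightarrow> b i \<bullet> (S *v b j) = (if i = j then 1 else 0)" by blast
  have "dim ((\<lambda>j. S *v b j) ` J) \<le> card ((\<lambda>j. S *v b j) ` J)"
    using insert by (intro dim_le_card') auto
  also have "\<dots> \<le> card J" using insert by (intro card_image_le) auto
  also have "\<dots> < card (UNIV :: 'k set)"
    using insert by (intro psubset_card_mono) auto
  finally obtain x where x: "x \<noteq> 0" "\<And>y. y \<in> span ((\<lambda>j. S *v b j) ` J) \<Longrightarrow> orthogonal x y"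
    using orthogonal_to_subspace_exists[of "(\<lambda>j. S *v b j) ` J"] by auto
  have xb: "x \<bullet> (S *v b j) = 0" if "j \<in> J" for j
    using x(2)[of "S *v b j"] that by (auto simp: orthogonal_def intro: span_base)
  have sym: "u \<bullet> (S *v v) = v \<bullet> (S *v u)" for u v
  proof -
    have "transpose S = S" using S by (simp add: sym_pos_def_def)
    then show ?thesis by (metis dot_lmul_matrix inner_commute transpose_matrix_vector)
  qed
  have bx: "b j \<bullet> (S *v x) = 0" if "j \<in> J" for j
    using xb[OF that] sym[of x "b j"] by simp
  define c where "c = x \<bullet> (S *v x)"
  have c: "c > 0" using S x(1) by (simp add: c_def sym_pos_def_def)
  define b' where "b' = b(l := (1 / sqrt c) *\<^sub>R x)"
  have "b' i \<bullet> (S *v b' j) = (if i = j then 1 else 0)" if "i \<in> insert l J" "j \<in> insert l J" for i j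
    using that insert.hyps(2) b xb bx c
    by (auto simp: b'_def matrix_vector_mult_scaleR c_def[symmetric])
  then show ?case by blast
qed simp

text \<open>With an S-orthonormal basis as the columns of M one has M' S M = 1, so the inverse of M
  is a factor.\<close>

lemma sym_pos_def_factor:
  fixes S :: "real^'k^'k"
  assumes S: "sym_pos_def S"
  obtains A :: "real^'k^'k" where "transpose A ** A = S"
proof -
  obtain b :: "'k \<Rightarrow> real^'k" where b: "\<And>i j. b i \<bullet> (S *v b j) = (if i = j then 1 else 0)"
    using sym_pos_def_orthonormal[OF S, of UNIV] by auto
  define M :: "real^'k^'k" where "M = (\<chi> r i. b i $ r)"
  have M: "transpose M ** (S ** M) = mat 1"
    using b by (simp add: vec_eq_iff M_def matrix_matrix_mult_def transpose_def mat_def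
        inner_vec_def matrix_vector_mult_def)
  then have "(transpose M ** S) ** M = mat 1" by (simp add: matrix_mul_assoc)
  then have inv: "invertible M" using invertible_left_inverse by blast
  note Mi = matrix_inv_inverse[OF inv]
  define A where "A = matrix_inv M"
  have "transpose A ** A = transpose A ** (transpose M ** (S ** M)) ** A"
    by (simp add: M)
  also have "\<dots> = transpose (M ** A) ** S ** (M ** A)"
    by (simp add: matrix_transpose_mul matrix_mul_assoc)
  also have "\<dots> = S" by (simp add: A_def Mi transpose_mat)
  finally show ?thesis using that by blast
qed

text \<open>All four follow from S = A' A: a kernel vector of A would contradict definiteness, det S
  is the square of det A, and writing z = A' w turns the inverse form into |w|^2. The last identity
  is what makes an elliptical density radial after whitening.\<close>

lemma
  fixes S A :: "real^'k^'k"
  assumes S: "sym_pos_def S" and A: "transpose A ** A = S"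
  shows factor_invertible: "invertible A" "invertible (transpose A)"
    and sym_pos_def_det: "0 < det S"
    and inverse_quadratic_form: "z \<bullet> (matrix_inv S *v z) = (norm (matrix_inv (transpose A) *v z))\<^sup>2"
proof -
  have "x = 0" if "A *v x = 0" for x
  proof -
    have "x \<bullet> (S *v x) = 0"
      by (simp add: A[symmetric] matrix_vector_mul_assoc[symmetric] that del: transpose_matrix_vector)
    then show "x = 0" using S by (force simp: sym_pos_def_def)
  qed
  then show inv: "invertible A"
    using matrix_left_invertible_ker[of A] invertible_left_inverse by blast
  then show invt: "invertible (transpose A)" by (rule transpose_invertible)
  have "det A \<noteq> 0" using inv by (simp add: invertible_det_nz)
  then show "0 < det S"
    by (simp add: A[symmetric] det_mul) (metis mult_neg_neg mult_pos_pos not_less_iff_gr_or_eq)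
  define w where "w = matrix_inv (transpose A) *v z"
  have w: "transpose A *v w = z"
    using matrix_inv_inverse[OF invt] by (simp add: w_def matrix_vector_mul_assoc del: transpose_matrix_vector)
  have invS: "invertible S" using inv invt by (auto simp: A[symmetric] invertible_mult)
  have "S *v (matrix_inv A *v w) = z"
    using matrix_inv_inverse[OF inv] w
    by (simp add: A[symmetric] matrix_vector_mul_assoc matrix_mul_assoc[symmetric] del: transpose_matrix_vector)
  then have "matrix_inv S *v z = matrix_inv A *v w"
    using matrix_inv_inverse[OF invS] by (metis matrix_vector_mul_assoc matrix_vector_mul_lid)
  then have "z \<bullet> (matrix_inv S *v z) = (transpose A *v w) \<bullet> (matrix_inv A *v w)" by (simp only: w)
  also have "\<dots> = w \<bullet> (A *v (matrix_inv A *v w))"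
    by (simp add: dot_lmul_matrix)
  also have "\<dots> = (norm w)\<^sup>2"
    using matrix_inv_inverse[OF inv] by (simp add: matrix_vector_mul_assoc power2_norm_eq_inner)
  finally show "z \<bullet> (matrix_inv S *v z) = (norm (matrix_inv (transpose A) *v z))\<^sup>2" by (simp add: w_def)
qed

lemma sym_pos_def_congruence:
  fixes B :: "real^'n^'m" and S :: "real^'n^'n"
  assumes S: "sym_pos_def S" and B: "rank B = CARD('m)"
  shows "sym_pos_def (B ** S ** transpose B)"
  unfolding sym_pos_def_def
proof (intro conjI allI impI)
  have "transpose S = S" using S by (simp add: sym_pos_def_def)
  then show "transpose (B ** S ** transpose B) = B ** S ** transpose B"
    by (simp add: matrix_transpose_mul matrix_mul_assoc)
  fix x :: "real^'m" assume x: "x \<noteq> 0"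
  have "rank (transpose B) = CARD('m)" using B by (simp add: rank_transpose)
  then have "inj ((*v) (transpose B))" by (rule full_rank_injective[THEN iffD1])
  then have "transpose B *v x \<noteq> 0"
    using x by (metis injD matrix_vector_mult_0_right)
  then have "0 < (transpose B *v x) \<bullet> (S *v (transpose B *v x))"
    using S by (simp add: sym_pos_def_def)
  also have "\<dots> = x \<bullet> ((B ** S ** transpose B) *v x)"
    by (simp add: dot_lmul_matrix matrix_vector_mul_assoc[symmetric])
  finally show "0 < x \<bullet> ((B ** S ** transpose B) *v x)" .
qed

text \<open>This replaces the computation of determinants: total mass 1 makes each of
  \<open>a\<close> and \<open>b\<close> the reciprocal of one and the same integral, which therefore
  is neither 0 nor infinite. Where \<open>f\<close> is negative \<open>ennreal\<close> truncates it,
  and a nonnegative factor passes through the truncation.\<close>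

lemma density_proportional_unique:
  fixes f :: "'a \<Rightarrow> real"
  assumes [measurable]: "f \<in> borel_measurable M" and "0 \<le> a" "0 \<le> b"
    and a: "prob_space (density M (\<lambda>x. ennreal (a * f x)))"
    and b: "prob_space (density M (\<lambda>x. ennreal (b * f x)))"
  shows "a = b"
proof -
  have "ennreal c * (\<integral>\<^sup>+x. ennreal (f x) \<partial>M) = 1"
    if "0 \<le> c" "prob_space (density M (\<lambda>x. ennreal (c * f x)))" for c
    using prob_space.emeasure_space_1[OF that(2)] that(1)
    by (simp add: emeasure_density ennreal_mult' nn_integral_cmult cong: nn_integral_cong_simp)
  from this[of a] this[of b] assms
  have eq: "ennreal a * (\<integral>\<^sup>+x. ennreal (f x) \<partial>M) = 1" "ennreal b * (\<integral>\<^sup>+x. ennreal (f x) \<partial>M) = 1" by auto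
  then have "(\<integral>\<^sup>+x. ennreal (f x) \<partial>M) \<noteq> 0" "(\<integral>\<^sup>+x. ennreal (f x) \<partial>M) \<noteq> top"
    by (auto simp: ennreal_mult_eq_top_iff) (metis ennreal_mult_top ennreal_one_neq_top mult_zero_left top_neq_ennreal zero_neq_one)
  then show ?thesis using eq assms(2,3)
    by (metis ennreal_inj ennreal_mult_divide_eq)
qed

section \<open>Joint laws of independent variables\<close>

lemma indep_rv_distr:
  assumes "prob_space M" "indep_rv M S X T Y"
  shows "distr M (S \<Otimes>\<^sub>M T) (\<lambda>x. (X x, Y x)) = distr M S X \<Otimes>\<^sub>M distr M T Y"
proof (rule pair_measure_eqI[symmetric])
  interpret prob_space M by fact
  have [measurable]: "X \<in> measurable M S" "Y \<in> measurable M T"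
    and ind: "indep_set (sigma_sets (space M) {X -` A \<inter> space M | A. A \<in> sets S})
       (sigma_sets (space M) {Y -` A \<inter> space M | A. A \<in> sets T})"
    using assms(2) by (auto simp: indep_rv_def)
  show "sigma_finite_measure (distr M S X)" "sigma_finite_measure (distr M T Y)"
    by (auto intro!: prob_space_imp_sigma_finite prob_space_distr)
  fix A B assume "A \<in> sets (distr M S X)" "B \<in> sets (distr M T Y)"
  then have [measurable]: "A \<in> sets S" "B \<in> sets T" by auto
  have "prob ((X -` A \<inter> space M) \<inter> (Y -` B \<inter> space M)) = prob (X -` A \<inter> space M) * prob (Y -` B \<inter> space M)"
    by (rule indep_setD[OF ind]) (auto intro!: sigma_sets.Basic)
  moreover have "(\<lambda>x. (X x, Y x)) -` (A \<times> B) \<inter> space M = (X -` A \<inter> space M) \<inter> (Y -` B \<inter> space M)"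
    by auto
  ultimately show "emeasure (distr M S X) A * emeasure (distr M T Y) B
      = emeasure (distr M (S \<Otimes>\<^sub>M T) (\<lambda>x. (X x, Y x))) (A \<times> B)"
    by (simp add: emeasure_distr emeasure_eq_measure ennreal_mult)
qed (simp cong: sets_pair_measure_cong)

subsection \<open>Elliptical distributions\<close>

definition beta_weight :: "real \<Rightarrow> real \<Rightarrow> real \<Rightarrow> real" where
  "beta_weight p q w = (if 0 < w \<and> w < 1 then w powr (p - 1) * (1 - w) powr (q - 1) else 0)"

lemma beta_weight_nonneg [simp]: "0 \<le> beta_weight p q w"
  by (simp add: beta_weight_def)

lemma measurable_beta_weight [measurable]: "beta_weight p q \<in> borel_measurable borel"
  unfolding beta_weight_def [abs_def] by measurable

lemma beta_density_eq: "beta_density p q w = beta_weight p q w / Beta p q"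
  by (simp add: beta_density_def beta_weight_def)

lemma Beta_real_pos: "0 < p \<Longrightarrow> 0 < q \<Longrightarrow> 0 < Beta p (q::real)"
  by (simp add: Beta_def)

text \<open>Pointwise Jacobian identity for w = t / v at fixed v, with 1 / v the Jacobian. The
  powers of v cancel, and both sides vanish unless 0 < t < v.\<close>

lemma power_weight_beta_weight:
  assumes "0 < v"
  shows "power_weight (p + q) v * beta_weight p q (t / v) / v = power_weight p t * power_weight q (v - t)"
proof (cases "0 < t \<and> t < v")
  case True
  then have "1 - t / v = (v - t) / v" by (simp add: field_simps)
  moreover have "v powr (p + q - 1) = v powr (p - 1) * v powr (q - 1) * v"
    using assms by (simp add: powr_add powr_diff)
  ultimately show ?thesis using True assms
    by (simp add: power_weight_def beta_weight_def powr_divide)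
next
  case False
  then show ?thesis using assms by (auto simp: power_weight_def beta_weight_def zero_less_divide_iff)
qed

text \<open>The change of variables \<open>(t, u) = (v w, v (1 - w))\<close> behind the classical relation between Gamma and Beta
  variables.\<close>

lemma nn_integral_beta_split:
  fixes \<phi> g :: "real \<Rightarrow> ennreal"
  assumes [measurable]: "\<phi> \<in> borel_measurable borel" "g \<in> borel_measurable borel"
  shows "(\<integral>\<^sup>+t. \<integral>\<^sup>+u. \<phi> t * g (t + u) * ennreal (power_weight p t) * ennreal (power_weight q u) \<partial>lborel \<partial>lborel)
    = (\<integral>\<^sup>+v. \<integral>\<^sup>+w. \<phi> (v * w) * g v * ennreal (power_weight (p + q) v) * ennreal (beta_weight p q w) \<partial>lborel \<partial>lborel)"
proof -
  have inner: "(\<integral>\<^sup>+w. \<phi> (v * w) * g v * ennreal (power_weight (p + q) v) * ennreal (beta_weight p q w) \<partial>lborel)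
    = (\<integral>\<^sup>+t. \<phi> t * g v * ennreal (power_weight p t * power_weight q (v - t)) \<partial>lborel)" for v
  proof (cases "0 < v")
    case True
    have "(\<integral>\<^sup>+w. \<phi> (v * w) * g v * ennreal (power_weight (p + q) v) * ennreal (beta_weight p q w) \<partial>lborel)
      = ennreal \<bar>1 / v\<bar> * (\<integral>\<^sup>+t. \<phi> (v * (0 + (1 / v) * t)) * g v * ennreal (power_weight (p + q) v)
          * ennreal (beta_weight p q (0 + (1 / v) * t)) \<partial>lborel)"
      using True by (intro nn_integral_real_affine) auto
    also have "\<dots> = (\<integral>\<^sup>+t. ennreal \<bar>1 / v\<bar> * (\<phi> (v * (0 + (1 / v) * t)) * g v * ennreal (power_weight (p + q) v)
          * ennreal (beta_weight p q (0 + (1 / v) * t))) \<partial>lborel)"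
      by (rule nn_integral_cmult[symmetric]) measurable
    also have "\<dots> = (\<integral>\<^sup>+t. \<phi> t * g v * ennreal (power_weight p t * power_weight q (v - t)) \<partial>lborel)"
    proof (rule nn_integral_cong)
      fix t
      have "ennreal \<bar>1 / v\<bar> * (\<phi> (v * (0 + (1 / v) * t)) * g v * ennreal (power_weight (p + q) v)
          * ennreal (beta_weight p q (0 + (1 / v) * t)))
        = \<phi> t * g v * (ennreal (power_weight (p + q) v) * ennreal (beta_weight p q (t / v)) * ennreal (1 / v))"
        using True by (simp add: mult_ac)
      also have "ennreal (power_weight (p + q) v) * ennreal (beta_weight p q (t / v)) * ennreal (1 / v)
        = ennreal (power_weight (p + q) v * beta_weight p q (t / v) / v)"
        using True by (simp flip: ennreal_mult)
      finally show "ennreal \<bar>1 / v\<bar> * (\<phi> (v * (0 + (1 / v) * t)) * g v * ennreal (power_weight (p + q) v)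
          * ennreal (beta_weight p q (0 + (1 / v) * t)))
        = \<phi> t * g v * ennreal (power_weight p t * power_weight q (v - t))"
        by (simp only: power_weight_beta_weight[OF True])
    qed
    finally show ?thesis .
  next
    case False
    then have "power_weight (p + q) v = 0" "\<And>t. power_weight p t * power_weight q (v - t) = 0"
      by (auto simp: power_weight_def)
    then show ?thesis by (simp only: ennreal_0 mult_zero_left mult_zero_right)
  qed
  have "(\<integral>\<^sup>+v. \<integral>\<^sup>+w. \<phi> (v * w) * g v * ennreal (power_weight (p + q) v) * ennreal (beta_weight p q w) \<partial>lborel \<partial>lborel)
    = (\<integral>\<^sup>+v. \<integral>\<^sup>+t. \<phi> t * g v * ennreal (power_weight p t * power_weight q (v - t)) \<partial>lborel \<partial>lborel)"
    by (simp only: inner)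
  also have "\<dots> = (\<integral>\<^sup>+t. \<integral>\<^sup>+v. \<phi> t * g v * ennreal (power_weight p t * power_weight q (v - t)) \<partial>lborel \<partial>lborel)"
    by (rule lborel_pair.Fubini') measurable
  also have "\<dots> = (\<integral>\<^sup>+t. \<integral>\<^sup>+u. \<phi> t * g (t + u) * ennreal (power_weight p t * power_weight q (t + u - t)) \<partial>lborel \<partial>lborel)"
    by (intro nn_integral_cong nn_integral_lborel_translate[symmetric]) measurable
  finally show ?thesis by (simp add: ennreal_mult mult.assoc)
qed

text \<open>The law is tested on indicators. Here \<open>g\<close> is the generator in the larger
  dimension and \<open>H\<close> its tail integral against the power weight with exponent q;
  \<open>H\<close> is prescribed for t > 0 only, because \<open>power_weight p\<close> kills the
  rest. Normalizing the Beta density contributes the divisor \<open>Beta p q\<close>.\<close>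

lemma radial_beta_product:
  fixes g H :: "real \<Rightarrow> real"
  assumes N: "prob_space N" and pq: "0 < p" "0 < q" and K: "0 \<le> K"
    and [measurable]: "g \<in> borel_measurable borel" "H \<in> borel_measurable borel"
    and R: "distr N borel R = density lborel (\<lambda>v. ennreal (K * power_weight (p + q) v * g v))"
    and W: "distributed N lborel W (\<lambda>w. ennreal (beta_density p q w))"
    and ind: "indep_rv N borel R borel W"
    and H: "\<And>t. 0 < t \<Longrightarrow> ennreal (H t) = (\<integral>\<^sup>+u. ennreal (g (t + u) * power_weight q u) \<partial>lborel)"
  shows "distr N borel (\<lambda>\<omega>. R \<omega> * W \<omega>)
    = density lborel (\<lambda>t. ennreal (K / Beta p q * power_weight p t * H t))"
proof (rule measure_eqI)
  fix S assume "S \<in> sets (distr N borel (\<lambda>\<omega>. R \<omega> * W \<omega>))"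
  then have [measurable]: "S \<in> sets borel" by simp
  have [measurable]: "R \<in> borel_measurable N" "W \<in> borel_measurable N"
    using ind by (auto simp: indep_rv_def)
  have W': "distr N borel W = density lborel (\<lambda>w. ennreal (beta_density p q w))"
    using W by (simp add: distributed_def cong: distr_cong)
  have [measurable]: "beta_density p q \<in> borel_measurable borel"
    by (simp add: beta_density_eq[abs_def])
  define k where "k = K / Beta p q"
  have k: "0 \<le> k" using K Beta_real_pos[OF pq] by (simp add: k_def)
  let ?\<phi> = "indicator S :: real \<Rightarrow> ennreal"
  interpret RR: sigma_finite_measure "distr N borel R"
    using N by (intro prob_space_imp_sigma_finite prob_space.prob_space_distr) auto
  interpret WW: sigma_finite_measure "distr N borel W"
    using N by (intro prob_space_imp_sigma_finite prob_space.prob_space_distr) auto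
  have "emeasure (distr N borel (\<lambda>\<omega>. R \<omega> * W \<omega>)) S = (\<integral>\<^sup>+\<omega>. ?\<phi> (R \<omega> * W \<omega>) \<partial>N)"
    by (subst nn_integral_indicator[symmetric], simp, subst nn_integral_distr) auto
  also have "\<dots> = (\<integral>\<^sup>+x. ?\<phi> (fst x * snd x) \<partial>distr N (borel \<Otimes>\<^sub>M borel) (\<lambda>\<omega>. (R \<omega>, W \<omega>)))"
    by (subst nn_integral_distr) auto
  also have "\<dots> = (\<integral>\<^sup>+v. \<integral>\<^sup>+w. ?\<phi> (v * w) \<partial>distr N borel W \<partial>distr N borel R)"
    unfolding indep_rv_distr[OF N ind]
    by (subst WW.nn_integral_fst[symmetric]) (auto cong: measurable_cong_sets)
  also have "\<dots> = (\<integral>\<^sup>+v. ennreal (K * power_weight (p + q) v * g v) * (\<integral>\<^sup>+w. ennreal (beta_density p q w) * ?\<phi> (v * w) \<partial>lborel) \<partial>lborel)"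
    unfolding R W' by (simp add: nn_integral_density)
  also have "\<dots> = (\<integral>\<^sup>+v. \<integral>\<^sup>+w. ennreal k * (?\<phi> (v * w) * ennreal (g v) * ennreal (power_weight (p + q) v) * ennreal (beta_weight p q w)) \<partial>lborel \<partial>lborel)"
  proof (rule nn_integral_cong)
    fix v
    \<comment> \<open>The sign of \<open>g\<close> is unspecified, so \<open>ennreal\<close> is
      distributed over products only by pulling out nonnegative factors.\<close>
    have *: "ennreal (K * power_weight (p + q) v * g v) * (ennreal (beta_density p q w) * ?\<phi> (v * w))
      = ennreal k * (?\<phi> (v * w) * ennreal (g v) * ennreal (power_weight (p + q) v) * ennreal (beta_weight p q w))" for w
    proof -
      have "ennreal (K * power_weight (p + q) v * g v) * ennreal (beta_density p q w)
         = ennreal K * ennreal (power_weight (p + q) v) * ennreal (g v) * ennreal (1 / Beta p q) * ennreal (beta_weight p q w)"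
      proof -
        have "beta_density p q w = 1 / Beta p q * beta_weight p q w" by (simp add: beta_density_eq)
        moreover have "0 \<le> 1 / Beta p q" using Beta_real_pos[OF pq] by simp
        ultimately show ?thesis
          using K by (simp only: ennreal_mult' power_weight_nonneg mult_nonneg_nonneg mult.assoc)
      qed
      also have "\<dots> = ennreal k * (ennreal (g v) * ennreal (power_weight (p + q) v) * ennreal (beta_weight p q w))"
      proof -
        have "0 \<le> 1 / Beta p q" using Beta_real_pos[OF pq] by simp
        then have "ennreal k = ennreal K * ennreal (1 / Beta p q)"
          using K by (simp add: k_def flip: ennreal_mult)
        then show ?thesis by (simp only: mult_ac)
      qed
      finally have "ennreal (K * power_weight (p + q) v * g v) * ennreal (beta_density p q w)
        = ennreal k * (ennreal (g v) * ennreal (power_weight (p + q) v) * ennreal (beta_weight p q w))" .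
      from arg_cong[OF this, of "\<lambda>x. x * ?\<phi> (v * w)"] show ?thesis by (simp only: mult_ac)
    qed
    show "ennreal (K * power_weight (p + q) v * g v) * (\<integral>\<^sup>+w. ennreal (beta_density p q w) * ?\<phi> (v * w) \<partial>lborel)
      = (\<integral>\<^sup>+w. ennreal k * (?\<phi> (v * w) * ennreal (g v) * ennreal (power_weight (p + q) v) * ennreal (beta_weight p q w)) \<partial>lborel)"
      by (subst nn_integral_cmult[symmetric]) (simp_all add: *)
  qed
  also have "\<dots> = ennreal k * (\<integral>\<^sup>+v. \<integral>\<^sup>+w. ?\<phi> (v * w) * ennreal (g v) * ennreal (power_weight (p + q) v) * ennreal (beta_weight p q w) \<partial>lborel \<partial>lborel)"
    by (simp add: nn_integral_cmult)
  also have "\<dots> = ennreal k * (\<integral>\<^sup>+t. \<integral>\<^sup>+u. ?\<phi> t * ennreal (g (t + u)) * ennreal (power_weight p t) * ennreal (power_weight q u) \<partial>lborel \<partial>lborel)"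
    by (subst nn_integral_beta_split) auto
  also have "\<dots> = ennreal k * (\<integral>\<^sup>+t. ennreal (power_weight p t * H t) * ?\<phi> t \<partial>lborel)"
  proof (intro arg_cong2[where f="(*)"] refl nn_integral_cong)
    fix t
    have "(\<integral>\<^sup>+u. ?\<phi> t * ennreal (g (t + u)) * ennreal (power_weight p t) * ennreal (power_weight q u) \<partial>lborel)
      = (\<integral>\<^sup>+u. (ennreal (power_weight p t) * ?\<phi> t) * ennreal (g (t + u) * power_weight q u) \<partial>lborel)"
      by (simp add: ennreal_mult'[OF power_weight_nonneg] ennreal_mult''[OF power_weight_nonneg] mult_ac)
    also have "\<dots> = (ennreal (power_weight p t) * ?\<phi> t) * (\<integral>\<^sup>+u. ennreal (g (t + u) * power_weight q u) \<partial>lborel)"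
      by (rule nn_integral_cmult) measurable
    also have "\<dots> = ennreal (power_weight p t * H t) * ?\<phi> t"
    proof (cases "0 < t")
      case True
      show ?thesis
        unfolding H[OF True, symmetric] unfolding ennreal_mult'[OF power_weight_nonneg] by (simp only: mult_ac)
    qed (simp add: power_weight_def)
    finally show "(\<integral>\<^sup>+u. ?\<phi> t * ennreal (g (t + u)) * ennreal (power_weight p t) * ennreal (power_weight q u) \<partial>lborel)
      = ennreal (power_weight p t * H t) * ?\<phi> t" .
  qed
  also have "\<dots> = emeasure (density lborel (\<lambda>t. ennreal (k * power_weight p t * H t))) S"
    using k by (simp add: emeasure_density ennreal_mult' mult.assoc flip: nn_integral_cmult)
  finally show "emeasure (distr N borel (\<lambda>\<omega>. R \<omega> * W \<omega>)) S
      = emeasure (density lborel (\<lambda>t. ennreal (K / Beta p q * power_weight p t * H t))) S"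
    by (simp add: k_def)
qed simp

text \<open>Polar coordinates read backwards: R and U together have the law of the squared norm and
  the direction of a vector with density proportional to h(|x|^2), and A' carries that vector to an
  elliptical density of the same shape as that of Z. The constants agree because both densities have
  mass 1.\<close>

lemma elliptical_stoch_rep:
  fixes Z :: "'a \<Rightarrow> real^'k"
  assumes M: "prob_space M" and Z: "elliptical M Z \<nu> S h" and [measurable]: "h \<in> borel_measurable borel"
    and A: "transpose A ** A = S"
    and N: "prob_space N" and R_nonneg: "\<forall>\<omega>\<in>space N. 0 \<le> R \<omega>"
    and U: "distr N borel U = uniform_sphere" and ind: "indep_rv N borel R borel U"
    and K: "0 \<le> K"
    and R: "distr N borel R = density lborel (\<lambda>v. ennreal (K * power_weight (real CARD('k) / 2) v * h v))"
  shows "stoch_rep M Z \<nu> S A N R U"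
proof -
  define p where "p = real CARD('k) / 2"
  interpret \<sigma>: prob_space "uniform_sphere :: (real^'k) measure" by (rule prob_space_uniform_sphere)
  have [measurable]: "R \<in> borel_measurable N" "U \<in> borel_measurable N"
    using ind by (auto simp: indep_rv_def)
  have S: "sym_pos_def S" and h: "\<And>u. 0 \<le> u \<Longrightarrow> 0 \<le> h u"
    using Z by (auto simp: elliptical_def)
  define \<kappa> where "\<kappa> = measure lborel (cball (0::real^'k) 1) * (real CARD('k) / 2)"
  have \<kappa>: "0 < \<kappa>" using emeasure_unit_cball(1)[where 'a="real^'k"] by (simp add: \<kappa>_def)
  define k where "k = K / \<kappa>"
  have k: "0 \<le> k" using K \<kappa> by (simp add: k_def)
  define P where "P x = ((norm x)\<^sup>2, sgn x)" for x :: "real^'k"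
  have [measurable]: "P \<in> borel \<rightarrow>\<^sub>M borel \<Otimes>\<^sub>M borel" unfolding P_def by measurable
  define f where "f x = ennreal (k * h ((norm x)\<^sup>2))" for x :: "real^'k"
  have [measurable]: "f \<in> borel_measurable borel" unfolding f_def by measurable
  have "distr N (borel \<Otimes>\<^sub>M borel) (\<lambda>\<omega>. (R \<omega>, U \<omega>))
    = density lborel (\<lambda>v. ennreal (K * power_weight p v * h v)) \<Otimes>\<^sub>M uniform_sphere"
    by (simp add: indep_rv_distr[OF N ind] U R p_def)
  also have "\<dots> = density (density lborel (\<lambda>v. ennreal (\<kappa> * power_weight p v))) (\<lambda>v. ennreal (k * h v)) \<Otimes>\<^sub>M density uniform_sphere (\<lambda>_. 1)"
  proof (intro arg_cong2[where f=pair_measure])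
    have "ennreal (\<kappa> * power_weight p v) * ennreal (k * h v) = ennreal (K * power_weight p v * h v)" for v
      using \<kappa> by (simp add: k_def mult_ac flip: ennreal_mult')
    then show "density lborel (\<lambda>v. ennreal (K * power_weight p v * h v))
      = density (density lborel (\<lambda>v. ennreal (\<kappa> * power_weight p v))) (\<lambda>v. ennreal (k * h v))"
      by (subst density_density_eq) auto
  qed (simp add: density_1)
  also have "\<dots> = density (density lborel (\<lambda>v. ennreal (\<kappa> * power_weight p v)) \<Otimes>\<^sub>M uniform_sphere) (\<lambda>(v, u). ennreal (k * h v) * 1)"
    by (rule pair_measure_density) (auto simp: density_1 \<sigma>.sigma_finite_measure_axioms)
  also have "density lborel (\<lambda>v. ennreal (\<kappa> * power_weight p v)) \<Otimes>\<^sub>M uniform_sphere = distr lborel (borel \<Otimes>\<^sub>M borel) P"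
    unfolding P_def[abs_def] \<kappa>_def p_def by (rule polar_lborel[symmetric])
  also have "density (distr lborel (borel \<Otimes>\<^sub>M borel) P) (\<lambda>(v, u). ennreal (k * h v) * 1) = distr (density lborel f) (borel \<Otimes>\<^sub>M borel) P"
    by (subst density_distr) (auto simp: P_def f_def[abs_def])
  finally have joint: "distr N (borel \<Otimes>\<^sub>M borel) (\<lambda>\<omega>. (R \<omega>, U \<omega>)) = distr (density lborel f) (borel \<Otimes>\<^sub>M borel) P" .
  define \<tau> where "\<tau> y = \<nu> + sqrt (fst y) *\<^sub>R (transpose A *v snd y)" for y :: "real \<times> (real^'k)"
  have [measurable]: "\<tau> \<in> borel \<Otimes>\<^sub>M borel \<rightarrow>\<^sub>M borel"
    unfolding \<tau>_def by (simp del: transpose_matrix_vector)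
  have "distr N borel (\<lambda>\<omega>. \<nu> + sqrt (R \<omega>) *\<^sub>R (transpose A *v U \<omega>))
    = distr (distr N (borel \<Otimes>\<^sub>M borel) (\<lambda>\<omega>. (R \<omega>, U \<omega>))) borel \<tau>"
    by (subst distr_distr) (auto simp: \<tau>_def comp_def)
  also have "\<dots> = distr (density lborel f) borel (\<tau> \<circ> P)"
    unfolding joint by (subst distr_distr) auto
  \<comment> \<open>The root undoes the squared norm, and x = |x| sgn x holds at the origin as well,
    so the reconstruction is affine in x.\<close>
  also have "\<tau> \<circ> P = (\<lambda>x. \<nu> + transpose A *v x)"
  proof
    fix x
    have "sqrt ((norm x)\<^sup>2) *\<^sub>R (transpose A *v sgn x) = transpose A *v (norm x *\<^sub>R sgn x)"
      by (simp add: matrix_vector_mult_scaleR del: transpose_matrix_vector)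
    also have "norm x *\<^sub>R sgn x = x" by (cases "x = 0") (simp_all add: sgn_div_norm)
    finally show "(\<tau> \<circ> P) x = \<nu> + transpose A *v x" by (simp add: \<tau>_def P_def)
  qed
  finally have d1: "distr N borel (\<lambda>\<omega>. \<nu> + sqrt (R \<omega>) *\<^sub>R (transpose A *v U \<omega>))
      = distr (density lborel f) borel (\<lambda>x. \<nu> + transpose A *v x)" .
  obtain c where c: "0 < c" "\<And>f. f \<in> borel_measurable borel \<Longrightarrow> distr (density lborel f) borel (\<lambda>x. \<nu> + transpose A *v x)
      = density lborel (\<lambda>z. ennreal c * f (matrix_inv (transpose A) *v (z - \<nu>)))"
    using affine_density[OF factor_invertible(2)[OF S A]] by blast
  define q where "q z = (z - \<nu>) \<bullet> (matrix_inv S *v (z - \<nu>))" for z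
  have [measurable]: "q \<in> borel_measurable borel" unfolding q_def by measurable
  have qn: "(norm (matrix_inv (transpose A) *v (z - \<nu>)))\<^sup>2 = q z" for z
    unfolding q_def by (rule inverse_quadratic_form[OF S A, symmetric])
  have d2: "distr N borel (\<lambda>\<omega>. \<nu> + sqrt (R \<omega>) *\<^sub>R (transpose A *v U \<omega>))
      = density lborel (\<lambda>z. ennreal (c * k * h (q z)))"
  proof -
    have "ennreal c * f (matrix_inv (transpose A) *v (z - \<nu>)) = ennreal (c * k * h (q z))" for z
      unfolding f_def qn using c(1) by (simp add: mult.assoc flip: ennreal_mult')
    moreover have "distr (density lborel f) borel (\<lambda>x. \<nu> + transpose A *v x)
        = density lborel (\<lambda>z. ennreal c * f (matrix_inv (transpose A) *v (z - \<nu>)))"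
      by (rule c(2)) measurable
    ultimately show ?thesis by (simp only: d1)
  qed
  obtain C where C: "0 < C" and Z': "distributed M lborel Z (\<lambda>z. ennreal (C * det S powr (-1/2) * h (q z)))"
    using Z by (auto simp: elliptical_def q_def)
  have d3: "distr M borel Z = density lborel (\<lambda>z. ennreal (C * det S powr (-1/2) * h (q z)))"
    using Z' by (simp add: distributed_def cong: distr_cong)
  have "c * k = C * det S powr (-1/2)"
  proof (rule density_proportional_unique)
    show "prob_space (density lborel (\<lambda>z. ennreal (c * k * h (q z))))"
      unfolding d2[symmetric] by (rule prob_space.prob_space_distr[OF N]) measurable
    show "prob_space (density lborel (\<lambda>z. ennreal (C * det S powr (-1/2) * h (q z))))"
      unfolding d3[symmetric] using Z' by (intro prob_space.prob_space_distr[OF M]) (auto simp: distributed_def)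
  qed (use c k C in auto)
  then show ?thesis
    unfolding stoch_rep_def using assms d2 d3 by auto
qed

text \<open>Whitening turns X into V with a density radial in |v|^2 = |Q v|^2 + residual, and
  integrating out the residual against its power weight produces \<open>H\<close>. The formula for
  \<open>H\<close> is asked only for t > 0, since t = 0 occurs at a single point; its sign is asked
  at 0 too, as the definition of an elliptical law demands.\<close>

lemma elliptical_marginal:
  fixes X :: "'a \<Rightarrow> real^'n" and B :: "real^'n^'m" and g H :: "real \<Rightarrow> real"
  assumes M: "prob_space M" and X: "elliptical M X \<mu> \<Sigma> g"
    and [measurable]: "g \<in> borel_measurable borel" "H \<in> borel_measurable borel"
    and less: "CARD('m) < CARD('n)" and B: "rank B = CARD('m)"
    and H_nonneg: "\<And>t. 0 \<le> t \<Longrightarrow> 0 \<le> H t"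
    and H: "\<And>t. 0 < t \<Longrightarrow> ennreal (H t)
      = (\<integral>\<^sup>+u. ennreal (g (t + u) * power_weight (real (CARD('n) - CARD('m)) / 2) u) \<partial>lborel)"
  shows "elliptical M (\<lambda>\<omega>. B *v X \<omega> + c) (B *v \<mu> + c) (B ** \<Sigma> ** transpose B) H"
proof -
  define p where "p = real (CARD('n) - CARD('m)) / 2"
  define S where "S = B ** \<Sigma> ** transpose B"
  define \<nu> where "\<nu> = B *v \<mu> + c"
  have \<Sigma>: "sym_pos_def \<Sigma>" using X by (simp add: elliptical_def)
  have S: "sym_pos_def S" unfolding S_def by (rule sym_pos_def_congruence[OF \<Sigma> B])
  obtain A :: "real^'n^'n" where A: "transpose A ** A = \<Sigma>" using sym_pos_def_factor[OF \<Sigma>] .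
  obtain A\<^sub>Y :: "real^'m^'m" where A\<^sub>Y: "transpose A\<^sub>Y ** A\<^sub>Y = S" using sym_pos_def_factor[OF S] .
  note inv = matrix_inv_inverse[OF factor_invertible(2)[OF \<Sigma> A]]
  note inv\<^sub>Y = matrix_inv_inverse[OF factor_invertible(2)[OF S A\<^sub>Y]]
  define L where "L = matrix_inv (transpose A)"
  have L: "invertible L" using inv by (auto simp: L_def invertible_def)
  note L_inv = matrix_inv_inverse[OF L]
  define q where "q z = (z - \<mu>) \<bullet> (matrix_inv \<Sigma> *v (z - \<mu>))" for z
  have [measurable]: "q \<in> borel_measurable borel" unfolding q_def by measurable
  obtain C where C: "0 < C" and X': "distributed M lborel X (\<lambda>z. ennreal (C * det \<Sigma> powr (-1/2) * g (q z)))"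
    using X by (auto simp: elliptical_def q_def)
  define C' where "C' = C * det \<Sigma> powr (-1/2)"
  have C': "0 < C'" using C sym_pos_def_det[OF \<Sigma> A] by (simp add: C'_def)
  have [measurable]: "X \<in> borel_measurable M" using X' by (simp add: distributed_def)
  have dX: "distr M borel X = density lborel (\<lambda>z. ennreal (C' * g (q z)))"
    using X' by (simp add: distributed_def C'_def cong: distr_cong)
  define V where "V \<omega> = - (L *v \<mu>) + L *v X \<omega>" for \<omega>
  have [measurable]: "V \<in> borel_measurable M" unfolding V_def by measurable
  obtain c1 where c1: "0 < c1" "\<And>f. f \<in> borel_measurable borel \<Longrightarrow> distr (density lborel f) borel (\<lambda>x. - (L *v \<mu>) + L *v x)
      = density lborel (\<lambda>z. ennreal c1 * f (matrix_inv L *v (z - (- (L *v \<mu>)))))"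
    using affine_density[OF L] by blast
  have q_std: "q (matrix_inv L *v (x - (- (L *v \<mu>)))) = (norm x)\<^sup>2" for x
  proof -
    have "matrix_inv L *v (x - (- (L *v \<mu>))) = matrix_inv L *v x + \<mu>"
      using L_inv by (simp add: matrix_vector_right_distrib matrix_vector_mul_assoc)
    moreover have "q z = (norm (L *v (z - \<mu>)))\<^sup>2" for z
      unfolding q_def L_def by (rule inverse_quadratic_form[OF \<Sigma> A])
    ultimately show ?thesis
      using L_inv by (simp add: matrix_vector_mul_assoc)
  qed
  define f where "f x = ennreal (c1 * C' * g ((norm x)\<^sup>2))" for x :: "real^'n"
  have dV: "distr M borel V = density lborel f"
  proof -
    have "distr M borel V = distr (distr M borel X) borel (\<lambda>x. - (L *v \<mu>) + L *v x)"
      by (subst distr_distr) (auto simp: V_def[abs_def] comp_def)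
    also have "\<dots> = density lborel (\<lambda>z. ennreal c1 * ennreal (C' * g (q (matrix_inv L *v (z - (- (L *v \<mu>)))))))"
      unfolding dX by (rule c1(2)) measurable
    also have "\<dots> = density lborel f"
      unfolding q_std f_def[abs_def] using c1(1) by (simp add: mult.assoc flip: ennreal_mult')
    finally show ?thesis .
  qed
  \<comment> \<open>The solution of \<open>A\<^sub>Y\<close>' Q = B A'. Its rows are orthonormal
    because \<open>transpose A\<^sub>Y ** A\<^sub>Y\<close> and B (A' A) B' both equal
    \<open>S\<close>.\<close>
  define Q where "Q = matrix_inv (transpose A\<^sub>Y) ** B ** transpose A"
  have "Q ** transpose Q = matrix_inv (transpose A\<^sub>Y) ** (B ** (transpose A ** A) ** transpose B) ** transpose (matrix_inv (transpose A\<^sub>Y))"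
    by (simp add: Q_def matrix_transpose_mul matrix_mul_assoc)
  also have "\<dots> = (matrix_inv (transpose A\<^sub>Y) ** transpose A\<^sub>Y) ** transpose (matrix_inv (transpose A\<^sub>Y) ** transpose A\<^sub>Y)"
    by (simp add: A S_def[symmetric] A\<^sub>Y[symmetric] matrix_transpose_mul matrix_mul_assoc)
  also have "\<dots> = mat 1" by (simp add: inv\<^sub>Y transpose_mat)
  finally have Q: "Q ** transpose Q = mat 1" .
  obtain \<kappa> where \<kappa>: "0 < \<kappa>" and proj: "distr lborel (borel \<Otimes>\<^sub>M borel) (\<lambda>x. (Q *v x, (norm x)\<^sup>2 - (norm (Q *v x))\<^sup>2))
     = lborel \<Otimes>\<^sub>M density lborel (\<lambda>v. ennreal (\<kappa> * power_weight p v))"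
    using projection_lborel[OF Q less] unfolding p_def by blast
  define T where "T x = (Q *v x, (norm x)\<^sup>2 - (norm (Q *v x))\<^sup>2)" for x
  have [measurable]: "T \<in> borel \<rightarrow>\<^sub>M borel \<Otimes>\<^sub>M borel" unfolding T_def by measurable
  define \<rho> where "\<rho> = density lborel (\<lambda>v. ennreal (\<kappa> * power_weight p v))"
  have [measurable_cong]: "sets \<rho> = sets borel" by (simp add: \<rho>_def)
  interpret \<rho>: sigma_finite_measure \<rho>
    unfolding \<rho>_def by (rule sigma_finite_density_real) measurable
  define f2 where "f2 y = ennreal (c1 * C' * g ((norm (fst y))\<^sup>2 + snd y))" for y :: "(real^'m) \<times> real"
  have [measurable]: "f2 \<in> borel_measurable (borel \<Otimes>\<^sub>M borel)" unfolding f2_def by measurable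
  define k where "k = c1 * C' * \<kappa>"
  have k: "0 < k" using c1 C' \<kappa> by (simp add: k_def)
  have inner: "(\<integral>\<^sup>+u. f2 (y, u) \<partial>\<rho>) = ennreal (k * H ((norm y)\<^sup>2))" if "y \<noteq> 0" for y
  proof -
    have "(\<integral>\<^sup>+u. f2 (y, u) \<partial>\<rho>) = (\<integral>\<^sup>+u. ennreal k * ennreal (g ((norm y)\<^sup>2 + u) * power_weight p u) \<partial>lborel)"
      unfolding \<rho>_def using \<kappa> c1 C'
      by (subst nn_integral_density)
        (auto simp: f2_def k_def mult_ac intro!: nn_integral_cong simp flip: ennreal_mult')
    also have "\<dots> = ennreal k * ennreal (H ((norm y)\<^sup>2))"
      using that by (subst nn_integral_cmult) (auto simp: H p_def)
    finally show ?thesis using k by (simp add: ennreal_mult')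
  qed
  define Y' where "Y' \<omega> = Q *v V \<omega>" for \<omega>
  have [measurable]: "Y' \<in> borel_measurable M" unfolding Y'_def by measurable
  have dY': "distr M borel Y' = density lborel (\<lambda>y. ennreal (k * H ((norm y)\<^sup>2)))"
  proof -
    have "distr M borel Y' = distr (distr (density lborel f) (borel \<Otimes>\<^sub>M borel) T) borel fst"
      unfolding dV[symmetric]
      by (subst distr_distr, simp, simp, subst distr_distr) (auto simp: Y'_def[abs_def] T_def comp_def)
    \<comment> \<open>\<open>f\<close> depends on \<open>x\<close> only through \<open>T x\<close>,
      as |x|^2 is |Q x|^2 plus the residual.\<close>
    also have "distr (density lborel f) (borel \<Otimes>\<^sub>M borel) T = density (lborel \<Otimes>\<^sub>M \<rho>) f2"
    proof -
      have "density (distr lborel (borel \<Otimes>\<^sub>M borel) T) f2 = distr (density lborel (\<lambda>x. f2 (T x))) (borel \<Otimes>\<^sub>M borel) T"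
        by (rule density_distr) measurable
      then show ?thesis
        unfolding T_def[abs_def] proj \<rho>_def by (simp add: f2_def f_def[abs_def])
    qed
    also have "distr (density (lborel \<Otimes>\<^sub>M \<rho>) f2) borel fst = density lborel (\<lambda>y. \<integral>\<^sup>+u. f2 (y, u) \<partial>\<rho>)"
    proof (rule measure_eqI)
      fix E assume "E \<in> sets (distr (density (lborel \<Otimes>\<^sub>M \<rho>) f2) borel fst)"
      then have [measurable]: "E \<in> sets borel" by simp
      have "emeasure (distr (density (lborel \<Otimes>\<^sub>M \<rho>) f2) borel fst) E
        = (\<integral>\<^sup>+x. f2 x * indicator E (fst x) \<partial>(lborel \<Otimes>\<^sub>M \<rho>))"
        by (subst nn_integral_indicator[symmetric], simp, subst nn_integral_distr, simp, simp, subst nn_integral_density) auto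
      also have "\<dots> = (\<integral>\<^sup>+y. (\<integral>\<^sup>+u. f2 (y, u) * indicator E y \<partial>\<rho>) \<partial>lborel)"
        by (subst \<rho>.nn_integral_fst[symmetric]) auto
      also have "\<dots> = (\<integral>\<^sup>+y. (\<integral>\<^sup>+u. f2 (y, u) \<partial>\<rho>) * indicator E y \<partial>lborel)"
        by (intro nn_integral_cong nn_integral_multc) measurable
      also have "\<dots> = emeasure (density lborel (\<lambda>y. \<integral>\<^sup>+u. f2 (y, u) \<partial>\<rho>)) E"
        by (subst emeasure_density) auto
      finally show "emeasure (distr (density (lborel \<Otimes>\<^sub>M \<rho>) f2) borel fst) E = emeasure (density lborel (\<lambda>y. \<integral>\<^sup>+u. f2 (y, u) \<partial>\<rho>)) E" .
    qed simp
    also have "\<dots> = density lborel (\<lambda>y. ennreal (k * H ((norm y)\<^sup>2)))"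
      using AE_lborel_singleton[of "0::real^'m"] by (intro density_cong) (auto simp: inner)
    finally show ?thesis .
  qed
  obtain c2 where c2: "0 < c2" "\<And>f. f \<in> borel_measurable borel \<Longrightarrow> distr (density lborel f) borel (\<lambda>x. \<nu> + transpose A\<^sub>Y *v x)
      = density lborel (\<lambda>z. ennreal c2 * f (matrix_inv (transpose A\<^sub>Y) *v (z - \<nu>)))"
    using affine_density[OF factor_invertible(2)[OF S A\<^sub>Y]] by blast
  have Y_eq: "B *v X \<omega> + c = \<nu> + transpose A\<^sub>Y *v Y' \<omega>" for \<omega>
  proof -
    have "transpose A\<^sub>Y *v Y' \<omega> = (transpose A\<^sub>Y ** matrix_inv (transpose A\<^sub>Y)) *v (B *v (transpose A *v V \<omega>))"
      by (simp add: Y'_def Q_def matrix_vector_mul_assoc matrix_mul_assoc del: transpose_matrix_vector)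
    also have "\<dots> = B *v (transpose A *v V \<omega>)" by (simp add: inv\<^sub>Y)
    also have "transpose A *v V \<omega> = X \<omega> - \<mu>"
      using inv by (simp add: V_def L_def matrix_vector_mult_diff_distrib matrix_vector_mul_assoc del: transpose_matrix_vector)
    finally show ?thesis by (simp add: \<nu>_def matrix_vector_mult_diff_distrib)
  qed
  define r where "r z = (z - \<nu>) \<bullet> (matrix_inv S *v (z - \<nu>))" for z
  have [measurable]: "r \<in> borel_measurable borel" unfolding r_def by measurable
  have rn: "(norm (matrix_inv (transpose A\<^sub>Y) *v (z - \<nu>)))\<^sup>2 = r z" for z
    unfolding r_def by (rule inverse_quadratic_form[OF S A\<^sub>Y, symmetric])
  have dY: "distr M borel (\<lambda>\<omega>. B *v X \<omega> + c) = density lborel (\<lambda>z. ennreal (c2 * k * H (r z)))"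
  proof -
    have "distr M borel (\<lambda>\<omega>. B *v X \<omega> + c) = distr (distr M borel Y') borel (\<lambda>x. \<nu> + transpose A\<^sub>Y *v x)"
      by (subst distr_distr) (simp_all add: Y_eq comp_def del: transpose_matrix_vector)
    also have "\<dots> = density lborel (\<lambda>z. ennreal (c2 * k * H (r z)))"
      unfolding dY' using c2 by (simp add: rn mult.assoc flip: ennreal_mult')
    finally show ?thesis .
  qed
  \<comment> \<open>The definition of an elliptical law splits \<open>det S powr (-1/2)\<close> off
    the constant; this is compensated here.\<close>
  define C2 where "C2 = c2 * k * det S powr (1/2)"
  have detS: "0 < det S" by (rule sym_pos_def_det[OF S A\<^sub>Y])
  have "C2 * det S powr (-1/2) = c2 * k"
    using detS by (simp add: C2_def flip: powr_add)
  moreover have "0 < C2" using c2 k detS by (simp add: C2_def)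
  ultimately show ?thesis
    unfolding elliptical_def S_def[symmetric] \<nu>_def[symmetric]
    using S H_nonneg dY
    by (intro conjI exI[of _ C2]) (auto simp: distributed_def r_def[symmetric] cong: distr_cong)
qed

text \<open>The quadratic form is 0 only at \<nu>, a null set, so changing a generator at 0 does not
  change the law. The sign at 0 must still be supplied because it is demanded of every nonnegative
  argument.\<close>

lemma elliptical_cong:
  fixes Z :: "'a \<Rightarrow> real^'k"
  assumes Z: "elliptical M Z \<nu> S h" and [measurable]: "h \<in> borel_measurable borel"
    and eq: "\<And>u. 0 < u \<Longrightarrow> h' u = h u" and "0 \<le> h' 0"
  shows "elliptical M Z \<nu> S h'"
proof -
  have S: "sym_pos_def S" using Z by (simp add: elliptical_def)
  obtain A :: "real^'k^'k" where A: "transpose A ** A = S" using sym_pos_def_factor[OF S] .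
  define q where "q z = (z - \<nu>) \<bullet> (matrix_inv S *v (z - \<nu>))" for z
  have [measurable]: "q \<in> borel_measurable borel" unfolding q_def by measurable
  have q: "0 < q z" if "z \<noteq> \<nu>" for z
  proof -
    note i = matrix_inv_inverse[OF factor_invertible(2)[OF S A]]
    have "matrix_inv (transpose A) *v (z - \<nu>) \<noteq> 0"
      using that i by (metis eq_iff_diff_eq_0 matrix_vector_mul_assoc matrix_vector_mul_lid matrix_vector_mult_0_right)
    then show ?thesis unfolding q_def inverse_quadratic_form[OF S A] by simp
  qed
  obtain C where C: "0 < C" and Z': "distributed M lborel Z (\<lambda>z. ennreal (C * det S powr (-1/2) * h (q z)))"
    using Z by (auto simp: elliptical_def q_def)
  \<comment> \<open>The new density is a measurable one altered at the single point \<nu>, which is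
    how its measurability follows from that of \<open>h\<close> alone.\<close>
  have fun_eq: "(\<lambda>z. ennreal (C * det S powr (-1/2) * h' (q z)))
     = (\<lambda>z. if z = \<nu> then ennreal (C * det S powr (-1/2) * h' (q \<nu>)) else ennreal (C * det S powr (-1/2) * h (q z)))"
    by (auto simp: eq q)
  have "density lborel (\<lambda>z. ennreal (C * det S powr (-1/2) * h (q z))) = density lborel (\<lambda>z. ennreal (C * det S powr (-1/2) * h' (q z)))"
  proof (rule density_cong)
    show "AE z in lborel. ennreal (C * det S powr (-1/2) * h (q z)) = ennreal (C * det S powr (-1/2) * h' (q z))"
      using AE_lborel_singleton[of \<nu>] by eventually_elim (simp add: eq q)
  qed (unfold fun_eq, measurable)
  moreover have "(\<lambda>z. ennreal (C * det S powr (-1/2) * h' (q z))) \<in> borel_measurable lborel"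
    unfolding fun_eq by measurable
  ultimately have "distributed M lborel Z (\<lambda>z. ennreal (C * det S powr (-1/2) * h' (q z)))"
    using Z' by (simp only: distributed_def)
  moreover have "0 \<le> h' u" if "0 \<le> u" for u
    using that eq[of u] assms(4) Z by (cases "u = 0") (auto simp: elliptical_def)
  ultimately show ?thesis
    unfolding elliptical_def q_def using S C by blast
qed

subsection \<open>The Hurwitz-Lerch zeta function\<close>

lemma nn_integral_Gamma_weight:
  assumes s: "0 < s" and \<beta>: "0 < \<beta>"
  shows "(\<integral>\<^sup>+u. ennreal (exp (- \<beta> * u) * power_weight s u) \<partial>lborel) = ennreal (Gamma s / \<beta> powr s)"
proof -
  let ?J = "\<integral>\<^sup>+u. ennreal (exp (- \<beta> * u) * power_weight s u) \<partial>lborel"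
  have "ennreal (Gamma s) = (\<integral>\<^sup>+t. ennreal (indicator {0..} t * t powr (s - 1) / exp t) \<partial>lborel)"
    by (rule Gamma_conv_nn_integral_real[OF s])
  also have "\<dots> = (\<integral>\<^sup>+t. ennreal (exp (- t) * power_weight s t) \<partial>lborel)"
    by (intro nn_integral_cong) (auto simp: power_weight_def exp_minus field_simps split: split_indicator)
  also have "\<dots> = ennreal \<bar>\<beta>\<bar> * (\<integral>\<^sup>+u. ennreal (exp (- (0 + \<beta> * u)) * power_weight s (0 + \<beta> * u)) \<partial>lborel)"
    using \<beta> by (intro nn_integral_real_affine) auto
  also have "\<dots> = ennreal \<bar>\<beta>\<bar> * (\<integral>\<^sup>+u. ennreal (\<beta> powr (s - 1)) * ennreal (exp (- \<beta> * u) * power_weight s u) \<partial>lborel)"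
    using \<beta> by (intro arg_cong2[where f="(*)"] nn_integral_cong refl)
      (auto simp: power_weight_def powr_mult zero_less_mult_iff mult_ac simp flip: ennreal_mult)
  also have "\<dots> = ennreal (\<beta> powr s) * ?J"
    using \<beta> by (subst nn_integral_cmult) (auto simp: powr_diff mult.assoc[symmetric] simp flip: ennreal_mult)
  finally have "ennreal (Gamma s) / ennreal (\<beta> powr s) = ?J"
    using \<beta> ennreal_mult_divide_eq[of "ennreal (\<beta> powr s)" ?J] by (simp add: mult.commute)
  then show ?thesis
    using s \<beta> by (simp add: divide_ennreal)
qed

lemma has_bochner_integral_Gamma_weight:
  assumes s: "0 < s" and \<beta>: "0 < \<beta>"
  shows "has_bochner_integral lborel (\<lambda>u. exp (- \<beta> * u) * power_weight s u) (Gamma s / \<beta> powr s)"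
  using nn_integral_Gamma_weight[OF assms] s
  by (intro has_bochner_integral_nn_integral) auto

lemma gml_generator_nonneg [simp]: "0 \<le> gml_generator a b r u"
  by (simp add: gml_generator_def)

lemma measurable_gml_generator [measurable]: "gml_generator a b r \<in> borel_measurable borel"
  unfolding gml_generator_def [abs_def] by measurable

text \<open>The generalized binomial coefficient of -r is (-1)^k times a rising factorial over k!,
  and its sign cancels against that of \<open>(- z) ^ k\<close>. Gamma quotients are the form in
  which the Hurwitz-Lerch series has these coefficients.\<close>

lemma Gamma_binomial_sums:
  fixes r z :: real
  assumes r: "0 < r" and z: "\<bar>z\<bar> < 1"
  shows "(\<lambda>k. Gamma (r + real k) / (Gamma r * fact k) * z ^ k) sums (1 - z) powr (- r)"
proof -
  have "(\<lambda>k. ((- r) gchoose k) * (- z) ^ k) sums (1 + (- z)) powr (- r)"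
    using z by (intro gen_binomial_real) simp
  moreover have "((- r) gchoose k) * (- z) ^ k = Gamma (r + real k) / (Gamma r * fact k) * z ^ k" for k
  proof -
    have "r \<notin> \<int>\<^sub>\<le>\<^sub>0" using r by (auto elim!: nonpos_Ints_cases)
    then have "pochhammer r k = Gamma (r + real k) / Gamma r" by (rule pochhammer_Gamma)
    moreover have "((- 1) ^ k * (- z) ^ k :: real) = z ^ k" by (simp flip: power_mult_distrib)
    ultimately show ?thesis by (simp add: gbinomial_pochhammer mult_ac)
  qed
  ultimately show ?thesis by simp
qed

lemma exp_neg_less_one: "0 < a \<Longrightarrow> 0 < t \<Longrightarrow> \<bar>exp (- a * t :: real)\<bar> < 1"
  by (simp add: mult_pos_pos)

text \<open>For \<open>t > 0\<close> the binomial series of \<open>(1 + exp (- a (t + u))) powr - r\<close> is dominated uniformly in \<open>u\<close>,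
  so it can be integrated term by term.\<close>

lemma gml_tail_sums:
  fixes a b r s t :: real
  assumes a: "0 < a" and b: "0 < b" and r: "0 < r" and s: "0 < s" and t: "0 < t"
  defines "c \<equiv> \<lambda>k::nat. Gamma (r + of_nat k) / fact k * ((- exp (- a * t)) ^ k / (of_nat k + b / a) powr s)"
  shows "integrable lborel (\<lambda>u. gml_generator a b r (t + u) * power_weight s u)"
    and "(\<lambda>k. exp (- b * t) * a powr - s * Gamma s / Gamma r * c k)
      sums (LINT u|lborel. gml_generator a b r (t + u) * power_weight s u)"
proof -
  define P where "P k = Gamma (r + real k) / (Gamma r * fact k)" for k
  have P: "0 \<le> P k" for k using r by (simp add: P_def)
  define x where "x = exp (- a * t)"
  have x: "0 < x" "\<bar>x\<bar> < 1" unfolding x_def using exp_neg_less_one[OF a t] by auto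
  \<comment> \<open>Decay rate in u of the k-th binomial term. It equals a * (k + b / a), so its
    power -s splits into a^(-s) and the Hurwitz-Lerch denominator with \<alpha> = b / a.\<close>
  define \<beta> where "\<beta> k = b + a * real k" for k
  have \<beta>: "0 < \<beta> k" "b \<le> \<beta> k" for k using a b by (auto simp: \<beta>_def add_pos_nonneg)
  define f where "f k u = P k * (- x) ^ k * exp (- b * t) * (exp (- \<beta> k * u) * power_weight s u)" for k u
  have int: "has_bochner_integral lborel (f k) (P k * (- x) ^ k * exp (- b * t) * (Gamma s / \<beta> k powr s))" for k
    unfolding f_def by (intro has_bochner_integral_mult_right has_bochner_integral_Gamma_weight s \<beta>)
  have norm_f: "norm (f k u) = P k * x ^ k * exp (- b * t) * (exp (- \<beta> k * u) * power_weight s u)" for k u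
    using P x by (simp add: f_def abs_mult power_abs)
  have int_norm: "has_bochner_integral lborel (\<lambda>u. norm (f k u)) (P k * x ^ k * exp (- b * t) * (Gamma s / \<beta> k powr s))" for k
    unfolding norm_f by (intro has_bochner_integral_mult_right has_bochner_integral_Gamma_weight s \<beta>)
  have sum_f: "(\<lambda>k. f k u) sums (gml_generator a b r (t + u) * power_weight s u)" for u
  proof (cases "0 < u")
    case True
    define z where "z = - exp (- a * (t + u))"
    have z: "\<bar>z\<bar> < 1" unfolding z_def using exp_neg_less_one[OF a, of "t + u"] t True by simp
    have "(\<lambda>k. P k * z ^ k * (exp (- b * (t + u)) * power_weight s u)) sums
      ((1 - z) powr (- r) * (exp (- b * (t + u)) * power_weight s u))"
      using Gamma_binomial_sums[OF r z] unfolding P_def by (rule sums_mult2)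
    moreover have "P k * z ^ k * (exp (- b * (t + u)) * power_weight s u) = f k u" for k
    proof -
      have "z = (- x) * exp (- a * u)" by (simp add: z_def x_def exp_add[symmetric] algebra_simps)
      then have "z ^ k * exp (- b * (t + u)) = (- x) ^ k * (exp (- a * u) ^ k * exp (- b * (t + u)))"
        by (simp only: power_mult_distrib mult.assoc)
      also have "exp (- a * u) ^ k * exp (- b * (t + u)) = exp (- b * t) * exp (- \<beta> k * u)"
        by (simp add: \<beta>_def algebra_simps flip: exp_of_nat_mult exp_add)
      finally have "z ^ k * exp (- b * (t + u)) = (- x) ^ k * (exp (- b * t) * exp (- \<beta> k * u))" .
      then have "P k * power_weight s u * (z ^ k * exp (- b * (t + u)))
        = P k * power_weight s u * ((- x) ^ k * (exp (- b * t) * exp (- \<beta> k * u)))" by (rule arg_cong)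
      then show ?thesis unfolding f_def by (simp only: mult_ac)
    qed
    moreover have "(1 - z) powr (- r) * (exp (- b * (t + u)) * power_weight s u) = gml_generator a b r (t + u) * power_weight s u"
      by (simp add: gml_generator_def z_def powr_minus_divide)
    ultimately show ?thesis by (simp only:)
  qed (simp add: f_def power_weight_def)
  \<comment> \<open>Here t > 0 enters, through x < 1. Up to factors free of k this one series
    majorizes the pointwise norms and, since \<open>\<beta> k\<close> \<ge> b, also their
    integrals.\<close>
  have "summable (\<lambda>k. P k * x ^ k)"
    using Gamma_binomial_sums[OF r x(2)] unfolding P_def by (rule sums_summable)
  note sum_P = summable_mult2[OF this]
  have sum_norm: "summable (\<lambda>k. norm (f k u))" for u
  proof (rule summable_comparison_test'[OF sum_P, where N=0])
    fix k
    have "exp (- \<beta> k * u) * power_weight s u \<le> power_weight s u"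
      using \<beta>[of k] by (cases "0 < u") (auto simp: power_weight_def mult_le_cancel_right1 zero_le_mult_iff)
    then have "P k * x ^ k * exp (- b * t) * (exp (- \<beta> k * u) * power_weight s u)
      \<le> P k * x ^ k * exp (- b * t) * power_weight s u"
      using P[of k] x by (intro mult_left_mono) auto
    then show "norm (norm (f k u)) \<le> P k * x ^ k * (exp (- b * t) * power_weight s u)"
      by (subst real_norm_def, subst abs_of_nonneg[OF norm_ge_zero]) (simp only: norm_f mult.assoc)
  qed
  have "summable (\<lambda>k. P k * x ^ k * (exp (- b * t) * (Gamma s / b powr s)))"
    by (rule sum_P)
  then have "summable (\<lambda>k. LINT u|lborel. norm (f k u))"
  proof (rule summable_comparison_test'[where N=0])
    fix k
    have "Gamma s / \<beta> k powr s \<le> Gamma s / b powr s"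
      using \<beta>[of k] b s by (intro divide_left_mono powr_mono2) auto
    then have "P k * x ^ k * exp (- b * t) * (Gamma s / \<beta> k powr s) \<le> P k * x ^ k * exp (- b * t) * (Gamma s / b powr s)"
      using P[of k] x by (intro mult_left_mono) auto
    moreover have "(LINT u|lborel. norm (f k u)) = P k * x ^ k * exp (- b * t) * (Gamma s / \<beta> k powr s)"
      by (rule has_bochner_integral_integral_eq[OF int_norm])
    moreover have "norm (LINT u|lborel. norm (f k u)) = (LINT u|lborel. norm (f k u))"
      by (subst real_norm_def, rule abs_of_nonneg, rule integral_nonneg_AE) simp
    ultimately show "norm (LINT u|lborel. norm (f k u)) \<le> P k * x ^ k * (exp (- b * t) * (Gamma s / b powr s))"
      by (simp only: mult.assoc)
  qed
  note suminf_facts = has_bochner_integral_iff[THEN iffD1, THEN conjunct1, OF int] AE_I2[OF sum_norm] this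
  have "integrable lborel (\<lambda>u. \<Sum>k. f k u)" "(\<lambda>k. integral\<^sup>L lborel (f k)) sums (LINT u|lborel. (\<Sum>k. f k u))"
    by (rule integrable_suminf[OF suminf_facts], rule sums_integral[OF suminf_facts])
  moreover have "integral\<^sup>L lborel (f k) = exp (- b * t) * a powr - s * Gamma s / Gamma r * c k" for k
  proof -
    have "\<beta> k = a * (real k + b / a)" using a by (simp add: \<beta>_def field_simps)
    then have "\<beta> k powr s = a powr s * (real k + b / a) powr s"
      using a b by (simp add: powr_mult)
    then show ?thesis
      using has_bochner_integral_integral_eq[OF int[of k]]
      by (simp add: c_def P_def x_def powr_minus divide_inverse mult_ac)
  qed
  moreover have "(\<lambda>u. \<Sum>k. f k u) = (\<lambda>u. gml_generator a b r (t + u) * power_weight s u)"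
    using sum_f by (simp add: sums_iff)
  ultimately show "integrable lborel (\<lambda>u. gml_generator a b r (t + u) * power_weight s u)"
    "(\<lambda>k. exp (- b * t) * a powr - s * Gamma s / Gamma r * c k)
      sums (LINT u|lborel. gml_generator a b r (t + u) * power_weight s u)"
    by simp_all
qed

text \<open>Convergence is read off from the integrated series, whose terms differ by a nonzero
  constant factor. It selects the series branch in the definition of \<open>hurwitz_lerch\<close>
  for t > 0.\<close>

lemma summable_hurwitz_lerch_series:
  fixes a b r s t :: real
  assumes "0 < a" "0 < b" "0 < r" "0 < s" "0 < t"
  shows "summable (\<lambda>k::nat. Gamma (r + of_nat k) / fact k * ((- exp (- a * t)) ^ k / (of_nat k + b / a) powr s))"
proof -
  have "Gamma s / Gamma r \<noteq> 0" using assms by (simp add: Gamma_eq_zero_iff) (auto elim!: nonpos_Ints_cases)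
  then show ?thesis
    using sums_summable[OF gml_tail_sums(2)[OF assms]] assms by (subst (asm) summable_cmult_iff) auto
qed

lemma gml_tail_integral:
  fixes a b r s t :: real
  assumes "0 < a" "0 < b" "0 < r" "0 < s" "0 < t"
  shows "(LINT u|lborel. gml_generator a b r (t + u) * power_weight s u)
    = exp (- b * t) * a powr - s * Gamma s / Gamma r
      * (\<Sum>k::nat. Gamma (r + of_nat k) / fact k * ((- exp (- a * t)) ^ k / (of_nat k + b / a) powr s))"
  by (rule sums_unique2[OF gml_tail_sums(2)[OF assms]
        sums_mult[OF summable_sums[OF summable_hurwitz_lerch_series[OF assms]]]])

text \<open>The integral form of the marginal generator. It is measurable and nonnegative at sight,
  so the distributional arguments work with it and the zeta function enters only at the end.\<close>

definition gml_tail :: "real \<Rightarrow> real \<Rightarrow> real \<Rightarrow> real \<Rightarrow> real \<Rightarrow> real" where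
  "gml_tail a b r s t = (LINT u|lborel. gml_generator a b r (t + u) * power_weight s u)"

lemma gml_tail_nonneg [simp]: "0 \<le> gml_tail a b r s t"
  unfolding gml_tail_def by (intro integral_nonneg_AE AE_I2) simp

lemma measurable_gml_tail [measurable]: "gml_tail a b r s \<in> borel_measurable borel"
  unfolding gml_tail_def [abs_def] by measurable

lemma gml_tail_hurwitz_lerch:
  assumes "0 < a" "0 < b" "0 < r" "0 < s" "0 < t"
  shows "gml_tail a b r s t
    = exp (- b * t) * a powr - s * Gamma s * hurwitz_lerch r (- exp (- a * t)) s (b / a)"
  unfolding hurwitz_lerch_def Let_def if_P[OF summable_hurwitz_lerch_series[OF assms]]
    gml_tail_def gml_tail_integral[OF assms] by simp

lemma ennreal_gml_tail:
  assumes "0 < a" "0 < b" "0 < r" "0 < s" "0 < t"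
  shows "ennreal (gml_tail a b r s t) = (\<integral>\<^sup>+u. ennreal (gml_generator a b r (t + u) * power_weight s u) \<partial>lborel)"
  unfolding gml_tail_def
  by (subst nn_integral_eq_integral[OF gml_tail_sums(1)[OF assms]]) auto

text \<open>The part of Abel's limit theorem needed for the value of the generator at \<open>t = 0\<close>, that is at \<open>z = - 1\<close>, where the
  series may converge only conditionally.  This value is irrelevant for the density but has to be nonnegative.\<close>

lemma suminf_nonneg_of_power_series:
  fixes a :: "nat \<Rightarrow> real"
  assumes a: "summable a" and nonneg: "\<And>x. 0 < x \<Longrightarrow> x < 1 \<Longrightarrow> 0 \<le> (\<Sum>k. a k * x ^ k)"
  shows "0 \<le> suminf a"
proof (rule ccontr)
  assume "\<not> 0 \<le> suminf a"
  then have neg: "suminf a < 0" by simp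
  define s where "s k = sum a {..k}" for k
  have s: "s \<longlonglongrightarrow> suminf a" unfolding s_def by (rule summable_LIMSEQ'[OF a])
  then have "eventually (\<lambda>k. s k < suminf a / 2) sequentially"
    using neg by (intro order_tendstoD(2)) auto
  then obtain N where N: "\<And>k. N \<le> k \<Longrightarrow> s k < suminf a / 2" by (auto simp: eventually_sequentially)
  have "Bseq s" using s by (intro convergent_imp_Bseq) (auto simp: convergent_def)
  then obtain K where K: "\<And>k. \<bar>s k\<bar> \<le> K" by (auto simp: Bseq_def)
  \<comment> \<open>\<open>C\<close> absorbs the partial sums before index N; from N on they lie
    below the negative number \<open>suminf a / 2\<close>.\<close>
  define C where "C = (\<Sum>k<N. \<bar>s k\<bar>)"
  have bound: "0 \<le> (1 - x) * C + suminf a / 2 * x ^ N" if x: "0 < x" "x < 1" for x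
  proof -
    have sm: "summable (\<lambda>k. s k * x ^ k)"
    proof (rule summable_comparison_test'[where N=0])
      show "summable (\<lambda>k. K * x ^ k)" using x by (intro summable_mult summable_geometric) auto
      show "norm (s k * x ^ k) \<le> K * x ^ k" for k
        using x K[of k] by (simp add: abs_mult power_abs mult_right_mono)
    qed
    \<comment> \<open>Summation by parts: consecutive partial sums differ by one coefficient, so the
      power series equals (1 - x) times the series of \<open>s k * x ^ k\<close>.\<close>
    have "(\<Sum>k. s k * x ^ k) = s 0 + (\<Sum>k. s (Suc k) * x ^ Suc k)"
      using suminf_split_head[OF sm] by simp
    moreover have "(\<Sum>k. s (Suc k) * x ^ Suc k) = (\<Sum>k. s k * x ^ Suc k + a (Suc k) * x ^ Suc k)"
      by (simp add: s_def algebra_simps)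
    moreover have sm1: "summable (\<lambda>k. s k * x ^ Suc k)"
      using summable_mult2[OF sm, of x] by (simp add: mult_ac)
    have sm2: "summable (\<lambda>k. a (Suc k) * x ^ Suc k)"
    proof -
      have "summable (\<lambda>k. s (Suc k) * x ^ Suc k - s k * x ^ Suc k)"
        using sm sm1 by (intro summable_diff) (subst summable_Suc_iff[where f="\<lambda>k. s k * x ^ k"])
      then show ?thesis by (simp add: s_def algebra_simps)
    qed
    have "(\<Sum>k. s k * x ^ Suc k + a (Suc k) * x ^ Suc k) = (\<Sum>k. s k * x ^ k) * x + (\<Sum>k. a (Suc k) * x ^ Suc k)"
      using suminf_add[OF sm1 sm2] suminf_mult2[OF sm, of x] by (simp add: mult_ac)
    moreover have "(\<Sum>k. a k * x ^ k) = a 0 + (\<Sum>k. a (Suc k) * x ^ Suc k)"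
      using suminf_split_head[of "\<lambda>k. a k * x ^ k"] sm2 summable_Suc_iff[where f="\<lambda>k. a k * x ^ k"] by simp
    ultimately have "(1 - x) * (\<Sum>k. s k * x ^ k) = (\<Sum>k. a k * x ^ k)"
      by (simp add: s_def algebra_simps)
    then have "0 \<le> (1 - x) * (\<Sum>k. s k * x ^ k)" using nonneg[OF x] by simp
    moreover have "(\<Sum>k. s k * x ^ k) = (\<Sum>k. s (k + N) * x ^ (k + N)) + (\<Sum>k<N. s k * x ^ k)"
      by (rule suminf_split_initial_segment[OF sm])
    moreover have "(\<Sum>k. s (k + N) * x ^ (k + N)) \<le> (\<Sum>k. suminf a / 2 * x ^ N * x ^ k)"
    proof (rule suminf_le)
      show "s (k + N) * x ^ (k + N) \<le> suminf a / 2 * x ^ N * x ^ k" for k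
        using mult_right_mono[of "s (k + N)" "suminf a / 2" "x ^ (k + N)"] N[of "k + N"] x
        by (simp add: power_add mult_ac)
      show "summable (\<lambda>k. s (k + N) * x ^ (k + N))"
        using sm by (subst summable_iff_shift)
      show "summable (\<lambda>k. suminf a / 2 * x ^ N * x ^ k)"
        using x by (intro summable_mult summable_geometric) auto
    qed
    moreover have "(\<Sum>k. suminf a / 2 * x ^ N * x ^ k) = suminf a / 2 * x ^ N * (1 / (1 - x))"
      using x by (subst suminf_mult) (auto simp: suminf_geometric intro: summable_geometric)
    moreover have "(\<Sum>k<N. s k * x ^ k) \<le> C"
      unfolding C_def
    proof (rule sum_mono)
      fix k
      have "s k * x ^ k \<le> \<bar>s k\<bar> * x ^ k" using x by (intro mult_right_mono) auto
      also have "\<dots> \<le> \<bar>s k\<bar> * 1" using x by (intro mult_left_mono power_le_one) auto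
      finally show "s k * x ^ k \<le> \<bar>s k\<bar>" by simp
    qed
    ultimately have "(\<Sum>k. s k * x ^ k) \<le> suminf a / 2 * x ^ N * (1 / (1 - x)) + C" by linarith
    then have "(1 - x) * (\<Sum>k. s k * x ^ k) \<le> (1 - x) * (suminf a / 2 * x ^ N * (1 / (1 - x)) + C)"
      using x by (intro mult_left_mono) auto
    also have "\<dots> = (1 - x) * C + suminf a / 2 * x ^ N"
    proof -
      have "(1 - x) * (1 / (1 - x)) = 1" using x by simp
      then have "suminf a / 2 * x ^ N * ((1 - x) * (1 / (1 - x))) = suminf a / 2 * x ^ N" by (simp only: mult_1_right)
      then show ?thesis by (simp only: distrib_left mult_ac add.commute)
    qed
    finally show ?thesis using \<open>0 \<le> (1 - x) * (\<Sum>k. s k * x ^ k)\<close> by simp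
  qed
  \<comment> \<open>As x tends to 1 from the left, the first summand vanishes and the second tends
    to \<open>suminf a / 2\<close>, which would have to be nonnegative.\<close>
  have "((\<lambda>x. (1 - x) * C + suminf a / 2 * x ^ N) \<longlongrightarrow> (1 - 1) * C + suminf a / 2 * 1 ^ N) (at_left (1::real))"
    by (intro tendsto_intros)
  moreover have "eventually (\<lambda>x. 0 \<le> (1 - x) * C + suminf a / 2 * x ^ N) (at_left (1::real))"
    using eventually_at_left_real[of 0 "1::real"] by (rule eventually_mono[OF _ bound]) auto
  ultimately have "0 \<le> (1 - 1) * C + suminf a / 2 * 1 ^ N"
    by (rule tendsto_lowerbound) simp
  then show False using neg by simp
qed

text \<open>The terms of the series at -1 are of size k^(r - 1 - s), so the parameters decide which
  branch applies. In the series branch, the power series at 0 < x < 1 is a positive multiple of the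
  tail integral at the t with exp (- a * t) = x, and the Abel limit transfers its sign; in the other
  branch the integrand is nonnegative.\<close>

lemma hurwitz_lerch_minus_one_nonneg:
  fixes a b r s :: real
  assumes "0 < a" "0 < b" "0 < r" "0 < s"
  shows "0 \<le> hurwitz_lerch r (- 1) s (b / a)"
proof -
  define c where "c k = Gamma (r + of_nat k) / fact k * ((- 1) ^ k / (of_nat k + b / a) powr s)" for k :: nat
  show ?thesis
  proof (cases "summable c")
    case True
    have "0 \<le> (\<Sum>k. c k * x ^ k)" if x: "0 < x" "x < 1" for x
    proof -
      define t where "t = - ln x / a"
      have t: "0 < t" using x assms by (simp add: t_def divide_neg_pos ln_less_zero)
      have xt: "exp (- a * t) = x" using x assms by (simp add: t_def)
      have ck: "Gamma (r + of_nat k) / fact k * ((- exp (- a * t)) ^ k / (of_nat k + b / a) powr s) = c k * x ^ k" for k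
      proof -
        have "(- x) ^ k = (- 1) ^ k * x ^ k" by (simp flip: power_mult_distrib)
        then show ?thesis by (simp only: xt c_def) simp
      qed
      have "0 \<le> (LINT u|lborel. gml_generator a b r (t + u) * power_weight s u)"
        by (intro integral_nonneg_AE AE_I2) simp
      also have "\<dots> = exp (- b * t) * a powr - s * Gamma s / Gamma r * (\<Sum>k. c k * x ^ k)"
        by (simp only: gml_tail_integral[OF assms t] ck)
      finally show ?thesis
      proof (rule mult_left_le_imp_le[where a=0, simplified])
        show "0 < exp (- b * t) * a powr - s * Gamma s / Gamma r" using assms by simp
      qed
    qed
    then have "0 \<le> suminf c" using True by (rule suminf_nonneg_of_power_series[rotated])
    moreover have "hurwitz_lerch r (- 1) s (b / a) = 1 / Gamma r * suminf c"
      using True unfolding hurwitz_lerch_def Let_def c_def by (rule if_P)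
    ultimately show ?thesis using assms by simp
  next
    case False
    then have "hurwitz_lerch r (- 1) s (b / a) = 1 / Gamma s * (LBINT t:{0..}. of_real t powr (s - 1)
        * exp (- (b / a) * of_real t) / (1 - (- 1) * exp (- of_real t)) powr r)"
      unfolding hurwitz_lerch_def Let_def c_def by (rule if_not_P)
    then show ?thesis
      using assms unfolding set_lebesgue_integral_def
      by (simp only:) (intro mult_nonneg_nonneg integral_nonneg_AE AE_I2, auto)
  qed
qed

subsection \<open>Product spaces and radial densities\<close>

lemma Int_stable_vimage: "Int_stable {X -` A \<inter> \<Omega> |A. A \<in> sets S}"
proof (safe intro!: Int_stableI)
  fix A B assume "A \<in> sets S" "B \<in> sets S"
  then show "\<exists>C. (X -` A \<inter> \<Omega>) \<inter> (X -` B \<inter> \<Omega>) = X -` C \<inter> \<Omega> \<and> C \<in> sets S"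
    by (intro exI[of _ "A \<inter> B"]) auto
qed

lemma indep_rvI:
  assumes M: "prob_space M" and [measurable]: "X \<in> measurable M S" "Y \<in> measurable M T"
    and eq: "\<And>A B. A \<in> sets S \<Longrightarrow> B \<in> sets T \<Longrightarrow>
      emeasure M {x \<in> space M. X x \<in> A \<and> Y x \<in> B}
      = emeasure M {x \<in> space M. X x \<in> A} * emeasure M {x \<in> space M. Y x \<in> B}"
  shows "indep_rv M S X T Y"
  unfolding indep_rv_def
proof (intro conjI)
  interpret prob_space M by fact
  show "indep_set (sigma_sets (space M) {X -` A \<inter> space M |A. A \<in> sets S})
    (sigma_sets (space M) {Y -` A \<inter> space M |A. A \<in> sets T})"
  proof (intro indep_set_sigma_sets Int_stable_vimage)
    show "indep_set {X -` A \<inter> space M |A. A \<in> sets S} {Y -` A \<inter> space M |A. A \<in> sets T}"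
    proof (safe intro!: indep_setI)
      fix A B assume AB: "A \<in> sets S" "B \<in> sets T"
      have sets: "{x \<in> space M. X x \<in> A \<and> Y x \<in> B} = (X -` A \<inter> space M) \<inter> (Y -` B \<inter> space M)"
        "{x \<in> space M. X x \<in> A} = X -` A \<inter> space M" "{x \<in> space M. Y x \<in> B} = Y -` B \<inter> space M"
        by auto
      show "prob ((X -` A \<inter> space M) \<inter> (Y -` B \<inter> space M)) = prob (X -` A \<inter> space M) * prob (Y -` B \<inter> space M)"
        using eq[OF AB] unfolding sets
        by (simp add: emeasure_eq_measure flip: ennreal_mult)
    qed (auto intro: measurable_sets)
  qed
qed fact+

lemma indep_rv_pair_measure:
  assumes M1: "prob_space M1" and M2: "prob_space M2"
    and [measurable]: "X \<in> measurable M1 S" "Y \<in> measurable M2 T"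
  shows "indep_rv (M1 \<Otimes>\<^sub>M M2) S (\<lambda>x. X (fst x)) T (\<lambda>x. Y (snd x))"
proof (rule indep_rvI)
  interpret M1: prob_space M1 by fact
  interpret M2: prob_space M2 by fact
  interpret P: pair_prob_space M1 M2 ..
  show "prob_space (M1 \<Otimes>\<^sub>M M2)" by (rule P.prob_space_axioms)
  fix A B assume [measurable]: "A \<in> sets S" "B \<in> sets T"
  have "{x \<in> space (M1 \<Otimes>\<^sub>M M2). X (fst x) \<in> A \<and> Y (snd x) \<in> B} = {x \<in> space M1. X x \<in> A} \<times> {y \<in> space M2. Y y \<in> B}"
    "{x \<in> space (M1 \<Otimes>\<^sub>M M2). X (fst x) \<in> A} = {x \<in> space M1. X x \<in> A} \<times> space M2"
    "{x \<in> space (M1 \<Otimes>\<^sub>M M2). Y (snd x) \<in> B} = space M1 \<times> {y \<in> space M2. Y y \<in> B}"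
    by (auto simp: space_pair_measure)
  then show "emeasure (M1 \<Otimes>\<^sub>M M2) {x \<in> space (M1 \<Otimes>\<^sub>M M2). X (fst x) \<in> A \<and> Y (snd x) \<in> B}
    = emeasure (M1 \<Otimes>\<^sub>M M2) {x \<in> space (M1 \<Otimes>\<^sub>M M2). X (fst x) \<in> A}
      * emeasure (M1 \<Otimes>\<^sub>M M2) {x \<in> space (M1 \<Otimes>\<^sub>M M2). Y (snd x) \<in> B}"
    by (simp add: M2.emeasure_pair_measure_Times M1.emeasure_space_1 M2.emeasure_space_1)
qed measurable

text \<open>Independence depends on the joint law alone. This carries it from a product space, where
  it is evident, to a space of another shape mapped onto it.\<close>

lemma indep_rv_measure_preserving:
  assumes N: "prob_space N" and [measurable]: "\<phi> \<in> measurable N M" and \<phi>: "distr N M \<phi> = M"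
    and ind: "indep_rv M S X T Y"
  shows "indep_rv N S (\<lambda>x. X (\<phi> x)) T (\<lambda>x. Y (\<phi> x))"
proof (rule indep_rvI[OF N])
  have M: "prob_space M"
    using prob_space.prob_space_distr[OF N, of \<phi> M] by (simp add: \<phi>)
  have [measurable]: "X \<in> measurable M S" "Y \<in> measurable M T"
    using ind by (auto simp: indep_rv_def)
  show "(\<lambda>x. X (\<phi> x)) \<in> measurable N S" "(\<lambda>x. Y (\<phi> x)) \<in> measurable N T" by measurable
  fix A B assume [measurable]: "A \<in> sets S" "B \<in> sets T"
  have lift: "emeasure N {x \<in> space N. P (\<phi> x)} = emeasure M {x \<in> space M. P x}"
    if [measurable]: "Measurable.pred M P" for P
  proof -
    have "emeasure M {x \<in> space M. P x} = emeasure (distr N M \<phi>) {x \<in> space M. P x}" by (simp add: \<phi>)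
    also have "\<dots> = emeasure N (\<phi> -` {x \<in> space M. P x} \<inter> space N)"
      by (rule emeasure_distr) measurable
    also have "\<phi> -` {x \<in> space M. P x} \<inter> space N = {x \<in> space N. P (\<phi> x)}"
      using measurable_space[of \<phi> N M] by auto
    finally show ?thesis by simp
  qed
  interpret M: prob_space M by fact
  have "emeasure M {x \<in> space M. X x \<in> A \<and> Y x \<in> B}
     = emeasure (distr M (S \<Otimes>\<^sub>M T) (\<lambda>x. (X x, Y x))) (A \<times> B)"
    by (subst emeasure_distr) (auto intro!: arg_cong[where f="emeasure M"])
  also have "\<dots> = emeasure (distr M S X) A * emeasure (distr M T Y) B"
    unfolding indep_rv_distr[OF M ind]
    by (intro sigma_finite_measure.emeasure_pair_measure_Times prob_space_imp_sigma_finite M.prob_space_distr) auto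
  also have "\<dots> = emeasure M {x \<in> space M. X x \<in> A} * emeasure M {x \<in> space M. Y x \<in> B}"
    by (simp add: emeasure_distr vimage_def Int_def conj_commute)
  moreover have "emeasure N {x \<in> space N. X (\<phi> x) \<in> A \<and> Y (\<phi> x) \<in> B} = emeasure M {x \<in> space M. X x \<in> A \<and> Y x \<in> B}"
    by (rule lift[where P="\<lambda>x. X x \<in> A \<and> Y x \<in> B"]) measurable
  moreover have "emeasure N {x \<in> space N. X (\<phi> x) \<in> A} = emeasure M {x \<in> space M. X x \<in> A}"
    by (rule lift[where P="\<lambda>x. X x \<in> A"]) measurable
  moreover have "emeasure N {x \<in> space N. Y (\<phi> x) \<in> B} = emeasure M {x \<in> space M. Y x \<in> B}"
    by (rule lift[where P="\<lambda>x. Y x \<in> B"]) measurable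
  ultimately show "emeasure N {x \<in> space N. X (\<phi> x) \<in> A \<and> Y (\<phi> x) \<in> B}
     = emeasure N {x \<in> space N. X (\<phi> x) \<in> A} * emeasure N {x \<in> space N. Y (\<phi> x) \<in> B}"
    by simp
qed

lemma prob_space_beta_density:
  assumes "0 < p" "0 < q"
  shows "prob_space (density lborel (\<lambda>w. ennreal (beta_density p q w)))"
proof (rule prob_spaceI)
  note B = Beta_real_pos[OF assms]
  have "(\<integral>\<^sup>+w. ennreal (beta_weight p q w) \<partial>lborel)
      = (\<integral>\<^sup>+w. ennreal (indicator {0..1} w * (w powr (p - 1) * (1 - w) powr (q - 1))) \<partial>lborel)"
    by (intro nn_integral_cong) (auto simp: beta_weight_def indicator_def)
  also have "\<dots> = ennreal (Beta p q)"
    using assms by (intro nn_integral_has_integral_lebesgue has_integral_Beta_real) auto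
  finally have Beta: "(\<integral>\<^sup>+w. ennreal (beta_weight p q w) \<partial>lborel) = ennreal (Beta p q)" .
  have "(\<integral>\<^sup>+w. ennreal (beta_density p q w) \<partial>lborel) = (\<integral>\<^sup>+w. ennreal (1 / Beta p q) * ennreal (beta_weight p q w) \<partial>lborel)"
  proof (rule nn_integral_cong)
    fix w
    have "beta_density p q w = 1 / Beta p q * beta_weight p q w" by (simp add: beta_density_eq)
    then show "ennreal (beta_density p q w) = ennreal (1 / Beta p q) * ennreal (beta_weight p q w)"
      using B by (simp only: ennreal_mult'' beta_weight_nonneg)
  qed
  also have "\<dots> = ennreal (1 / Beta p q) * ennreal (Beta p q)"
    by (subst nn_integral_cmult) (simp_all only: Beta measurable_lborel1, measurable)
  also have "\<dots> = 1" using B by (simp flip: ennreal_mult)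
  finally show "emeasure (density lborel (\<lambda>w. ennreal (beta_density p q w))) (space (density lborel (\<lambda>w. ennreal (beta_density p q w)))) = 1"
    by (simp add: emeasure_density beta_density_eq[abs_def])
qed

text \<open>Valid at v = 0 as well: \<open>0 powr x\<close> is 0 for every exponent, even the
  exponent 0 of the case n = 2, matching the convention of \<open>power_weight\<close>.\<close>

lemma gml_radial_density_eq:
  "gml_radial_density n a b r v
    = 1 / (LBINT t:{0..}. t powr (real n / 2 - 1) * gml_generator a b r t) * power_weight (real n / 2) v * gml_generator a b r v"
  by (auto simp: gml_radial_density_def power_weight_def)

text \<open>What has to be excluded is a normalizing integral that is zero or diverges, for which
  the division would yield the zero density. The integrand is at most exp (- b * v) times the power
  weight, a Gamma integral, and it is positive on the open half-line.\<close>

lemma prob_space_gml_radial_density: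
  assumes a: "0 < a" and b: "0 < b" and r: "0 < r" and n: "0 < n"
  shows "prob_space (density lborel (\<lambda>v. ennreal (gml_radial_density n a b r v)))"
proof (rule prob_spaceI)
  define p where "p = real n / 2"
  have p: "0 < p" using n by (simp add: p_def)
  let ?g = "gml_generator a b r"
  define J where "J = (\<integral>\<^sup>+v. ennreal (power_weight p v * ?g v) \<partial>lborel)"
  have "J \<le> (\<integral>\<^sup>+v. ennreal (exp (- b * v) * power_weight p v) \<partial>lborel)"
    unfolding J_def
  proof (intro nn_integral_mono ennreal_leI)
    fix v
    have "1 \<le> (1 + exp (- a * v)) powr r" using r by (intro ge_one_powr_ge_zero) auto
    then have "?g v \<le> exp (- b * v)" by (simp add: gml_generator_def divide_le_eq mult_le_cancel_left1)
    then show "power_weight p v * ?g v \<le> exp (- b * v) * power_weight p v"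
      by (subst mult.commute, intro mult_right_mono) auto
  qed
  also have "\<dots> < top" by (subst nn_integral_Gamma_weight[OF p b]) simp
  finally have J_fin: "J < top" .
  have "J \<noteq> 0"
  proof
    assume "J = 0"
    then have "AE v in lborel. power_weight p v * ?g v \<le> 0"
      unfolding J_def by (subst (asm) nn_integral_0_iff_AE) (auto simp: ennreal_eq_0_iff)
    moreover have "power_weight p v * ?g v > 0" if "0 < v" for v
    proof -
      have "0 < 1 + exp (- a * v)" by (simp add: add_pos_pos)
      then show ?thesis using that by (simp add: power_weight_def gml_generator_def)
    qed
    ultimately have "AE v in lborel. \<not> (0::real) < v"
      by (elim eventually_mono) (meson not_less)
    then have "emeasure lborel {v \<in> space lborel. v \<in> {0<..<1::real}} = 0"
      by (intro emeasure_eq_0_AE) (auto elim: eventually_mono)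
    moreover have "{v \<in> space lborel. v \<in> {0<..<1::real}} = {0<..<1}" by auto
    ultimately have "emeasure lborel {0<..<1::real} = 0" by (simp only:)
    then show False by simp
  qed
  define I where "I = (LBINT t:{0..}. t powr (real n / 2 - 1) * ?g t)"
  have "I = (LINT v|lborel. power_weight p v * ?g v)"
    unfolding I_def set_lebesgue_integral_def
    by (intro Bochner_Integration.integral_cong) (auto simp: power_weight_def p_def indicator_def)
  also have "\<dots> = enn2real J"
    unfolding J_def by (intro integral_eq_nn_integral) auto
  finally have I: "ennreal I = J" using J_fin by simp
  have I_pos: "0 < I" using I \<open>J \<noteq> 0\<close> by (metis ennreal_eq_0_iff not_less)
  have "(\<integral>\<^sup>+v. ennreal (gml_radial_density n a b r v) \<partial>lborel) = (\<integral>\<^sup>+v. ennreal (1 / I) * ennreal (power_weight p v * ?g v) \<partial>lborel)"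
  proof (rule nn_integral_cong)
    fix v
    have "gml_radial_density n a b r v = 1 / I * (power_weight p v * ?g v)"
      by (simp add: gml_radial_density_eq I_def p_def)
    then show "ennreal (gml_radial_density n a b r v) = ennreal (1 / I) * ennreal (power_weight p v * ?g v)"
      using I_pos by (simp only: ennreal_mult' less_imp_le zero_less_divide_1_iff)
  qed
  also have "\<dots> = ennreal (1 / I) * ennreal I"
    by (subst nn_integral_cmult) (auto simp: I J_def)
  also have "\<dots> = 1" using I_pos by (simp flip: ennreal_mult)
  finally show "emeasure (density lborel (\<lambda>v. ennreal (gml_radial_density n a b r v))) (space (density lborel (\<lambda>v. ennreal (gml_radial_density n a b r v)))) = 1"
    by (simp add: emeasure_density gml_radial_density_eq[abs_def])
qed

subsection \<open>Marginals of the generalized logistic distribution\<close>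

lemma GML_marginal:
  fixes X :: "'a \<Rightarrow> real^'n" and B :: "real^'n^'m"
  assumes M: "prob_space M" and abr: "0 < a" "0 < b" "0 < r" and X: "GML M X \<mu> \<Sigma> a b r"
    and less: "CARD('m) < CARD('n)" and B: "rank B = CARD('m)"
  shows "elliptical M (\<lambda>\<omega>. B *v X \<omega> + c) (B *v \<mu> + c) (B ** \<Sigma> ** transpose B)
    (gml_tail a b r (real (CARD('n) - CARD('m)) / 2))"
proof (rule elliptical_marginal[OF M _ _ _ less B])
  show "elliptical M X \<mu> \<Sigma> (gml_generator a b r)" using X by (simp add: GML_def)
  fix t :: real assume t: "0 < t"
  have "0 < real (CARD('n) - CARD('m)) / 2" using less by simp
  then show "ennreal (gml_tail a b r (real (CARD('n) - CARD('m)) / 2) t)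
    = (\<integral>\<^sup>+u. ennreal (gml_generator a b r (t + u) * power_weight (real (CARD('n) - CARD('m)) / 2) u) \<partial>lborel)"
    by (intro ennreal_gml_tail abr t)
qed simp_all

text \<open>By the Beta splitting, R W has density proportional to t^(m/2 - 1) times the marginal
  generator, exactly the radial law required for Y. The variables are arbitrary ones on an arbitrary
  space, so that the constructed and the given ones are served alike.\<close>

lemma GML_marginal_stoch_rep:
  fixes X :: "'a \<Rightarrow> real^'n" and B :: "real^'n^'m" and N :: "'b measure"
  assumes M: "prob_space M" and abr: "0 < a" "0 < b" "0 < r" and X: "GML M X \<mu> \<Sigma> a b r"
    and less: "CARD('m) < CARD('n)" and B: "rank B = CARD('m)"
    and N: "prob_space N" and R_nonneg: "\<forall>\<omega>\<in>space N. 0 \<le> R \<omega>"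
    and R: "distributed N lborel R (\<lambda>v. ennreal (gml_radial_density CARD('n) a b r v))"
    and W: "indep_beta_factor N R (real CARD('m) / 2) (real (CARD('n) - CARD('m)) / 2) W"
    and A\<^sub>Y: "transpose A\<^sub>Y ** A\<^sub>Y = B ** \<Sigma> ** transpose B"
    and U\<^sub>Y: "distr N borel U\<^sub>Y = uniform_sphere"
    and ind: "indep_rv N borel (\<lambda>\<omega>. R \<omega> * W \<omega>) borel U\<^sub>Y"
  shows "stoch_rep M (\<lambda>\<omega>. B *v X \<omega> + c) (B *v \<mu> + c) (B ** \<Sigma> ** transpose B)
    A\<^sub>Y N (\<lambda>\<omega>. R \<omega> * W \<omega>) U\<^sub>Y"
proof -
  define p where "p = real CARD('m) / 2"
  define q where "q = real (CARD('n) - CARD('m)) / 2"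
  have pq: "0 < p" "0 < q" and sum: "p + q = real CARD('n) / 2"
    using less by (auto simp: p_def q_def of_nat_diff add_divide_distrib[symmetric])
  define K where "K = 1 / (LBINT t:{0..}. t powr (real CARD('n) / 2 - 1) * gml_generator a b r t)"
  have K: "0 \<le> K"
    unfolding K_def set_lebesgue_integral_def
    by (intro divide_nonneg_nonneg integral_nonneg_AE AE_I2) auto
  have dR: "distr N borel R = density lborel (\<lambda>v. ennreal (K * power_weight (p + q) v * gml_generator a b r v))"
    using R by (simp add: distributed_def gml_radial_density_eq K_def sum cong: distr_cong)
  have "distr N borel (\<lambda>\<omega>. R \<omega> * W \<omega>)
    = density lborel (\<lambda>t. ennreal (K / Beta p q * power_weight p t * gml_tail a b r q t))"
    using W by (intro radial_beta_product[OF N pq K _ _ dR] ennreal_gml_tail abr pq)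
      (auto simp: indep_beta_factor_def p_def q_def)
  then show ?thesis
    using K Beta_real_pos[OF pq] W R_nonneg
    by (intro elliptical_stoch_rep[OF M GML_marginal[OF M abr X less B] _ A\<^sub>Y N _ U\<^sub>Y ind, where K="K / Beta p q"])
      (auto simp: indep_beta_factor_def p_def q_def)
qed

lemma GML_stoch_rep:
  fixes X :: "'a \<Rightarrow> real^'n" and N :: "'b measure"
  assumes M: "prob_space M" and X: "GML M X \<mu> \<Sigma> a b r" and A: "transpose A ** A = \<Sigma>"
    and N: "prob_space N" and R_nonneg: "\<forall>\<omega>\<in>space N. 0 \<le> R \<omega>"
    and R: "distributed N lborel R (\<lambda>v. ennreal (gml_radial_density CARD('n) a b r v))"
    and U: "distr N borel U = uniform_sphere" and ind: "indep_rv N borel R borel U"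
  shows "gml_stoch_rep M X \<mu> \<Sigma> a b r A N R U"
proof -
  define K where "K = 1 / (LBINT t:{0..}. t powr (real CARD('n) / 2 - 1) * gml_generator a b r t)"
  have "0 \<le> K"
    unfolding K_def set_lebesgue_integral_def
    by (intro divide_nonneg_nonneg integral_nonneg_AE AE_I2) auto
  moreover have "distr N borel R = density lborel (\<lambda>v. ennreal (K * power_weight (real CARD('n) / 2) v * gml_generator a b r v))"
    using R by (simp add: distributed_def gml_radial_density_eq K_def cong: distr_cong)
  ultimately show ?thesis
    unfolding gml_stoch_rep_def using X R
    by (intro conjI elliptical_stoch_rep[OF M _ _ A N R_nonneg U ind]) (auto simp: GML_def)
qed

section \<open>A common probability space for the radial, Beta and spherical variables\<close>

lemma distr_pair_snd:
  assumes M1: "prob_space M1" and M2: "sigma_finite_measure M2"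
  shows "distr (M1 \<Otimes>\<^sub>M M2) M2 snd = M2"
proof (rule measure_eqI)
  interpret M1: prob_space M1 by fact
  interpret M2: sigma_finite_measure M2 by fact
  fix A assume "A \<in> sets (distr (M1 \<Otimes>\<^sub>M M2) M2 snd)"
  then have A: "A \<in> sets M2" by simp
  then have "snd -` A \<inter> space (M1 \<Otimes>\<^sub>M M2) = space M1 \<times> A"
    using sets.sets_into_space by (fastforce simp: space_pair_measure)
  then show "emeasure (distr (M1 \<Otimes>\<^sub>M M2) M2 snd) A = emeasure M2 A"
    using A by (simp add: emeasure_distr M2.emeasure_pair_measure_Times M1.emeasure_space_1)
qed simp

text \<open>Nonnegativity of R and W is required at every sample point, while their laws give it
  almost surely; truncating at 0 repairs this and keeps the law.\<close>

lemma distr_max_0: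
  fixes M :: "real measure"
  assumes [measurable_cong]: "sets M = sets borel" and "AE x in M. 0 \<le> x"
  shows "distr M borel (max 0) = M"
proof -
  have "distr M borel (max 0) = distr M M (\<lambda>x. x)"
    using assms by (intro distr_cong_AE) (auto simp: max_def elim: eventually_mono)
  then show ?thesis by simp
qed

text \<open>The factors are paired as \<open>(R, W)\<close> and \<open>(U, U\<^sub>Y)\<close>, since then each required independence is between
  the two components of a product measure.\<close>

lemma independent_radial_beta_directions:
  fixes MR MW :: "real measure"
  assumes MR: "prob_space MR" "sets MR = sets borel" "AE v in MR. 0 \<le> v"
    and MW: "prob_space MW" "sets MW = sets borel" "AE w in MW. 0 \<le> w"
  obtains N :: "(real \<times> real \<times> (real^'n) \<times> (real^'m)) measure" and R W
    and U :: "_ \<Rightarrow> real^'n" and U\<^sub>Y :: "_ \<Rightarrow> real^'m"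
  where "prob_space N" "\<forall>\<omega>\<in>space N. 0 \<le> R \<omega>" "\<forall>\<omega>\<in>space N. 0 \<le> W \<omega>"
    "distr N borel R = MR" "distr N borel W = MW"
    "distr N borel U = uniform_sphere" "distr N borel U\<^sub>Y = uniform_sphere"
    "indep_rv N borel R borel U" "indep_rv N borel R borel W"
    "indep_rv N borel (\<lambda>\<omega>. R \<omega> * W \<omega>) borel U\<^sub>Y"
proof -
  let ?\<sigma>n = "uniform_sphere :: (real^'n) measure" and ?\<sigma>m = "uniform_sphere :: (real^'m) measure"
  have [measurable_cong]: "sets MR = sets borel" "sets MW = sets borel" by fact+
  define P where "P = MR \<Otimes>\<^sub>M MW"
  define D where "D = ?\<sigma>n \<Otimes>\<^sub>M ?\<sigma>m"
  have P: "prob_space P" unfolding P_def using MR MW by (intro prob_space_pair)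
  have D: "prob_space D" unfolding D_def by (intro prob_space_pair prob_space_uniform_sphere)
  define N' where "N' = P \<Otimes>\<^sub>M D"
  have N': "prob_space N'" unfolding N'_def by (intro prob_space_pair P D)
  have [measurable_cong]: "sets P = sets (borel \<Otimes>\<^sub>M borel)" "sets D = sets (borel \<Otimes>\<^sub>M borel)"
    unfolding P_def D_def by (intro sets_pair_measure_cong assms sets_uniform_sphere)+
  have [measurable_cong]: "sets N' = sets ((borel \<Otimes>\<^sub>M borel) \<Otimes>\<^sub>M (borel \<Otimes>\<^sub>M borel))"
    unfolding N'_def by (intro sets_pair_measure_cong) fact+
  \<comment> \<open>The factors are built as a pair of pairs, while the sample space has a
    right-nested tuple type. \<open>assoc\<close> and \<open>\<phi>\<close> are mutually inverse
    rebracketings, so \<open>\<phi>\<close> preserves measure and independence can be pulled back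
    along it.\<close>
  define assoc :: "(real \<times> real) \<times> (real^'n) \<times> (real^'m) \<Rightarrow> real \<times> real \<times> (real^'n) \<times> (real^'m)"
    where "assoc x = (fst (fst x), snd (fst x), snd x)" for x
  define \<phi> :: "real \<times> real \<times> (real^'n) \<times> (real^'m) \<Rightarrow> (real \<times> real) \<times> (real^'n) \<times> (real^'m)"
    where "\<phi> y = ((fst y, fst (snd y)), snd (snd y))" for y
  define N where "N = distr N' (borel \<Otimes>\<^sub>M borel \<Otimes>\<^sub>M borel \<Otimes>\<^sub>M borel) assoc"
  have [measurable]: "assoc \<in> N' \<rightarrow>\<^sub>M borel \<Otimes>\<^sub>M borel \<Otimes>\<^sub>M borel \<Otimes>\<^sub>M borel"
    unfolding assoc_def by measurable
  have [measurable]: "\<phi> \<in> borel \<Otimes>\<^sub>M borel \<Otimes>\<^sub>M borel \<Otimes>\<^sub>M borel \<rightarrow>\<^sub>M N'"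
    unfolding \<phi>_def by measurable
  have N: "prob_space N" unfolding N_def by (intro prob_space.prob_space_distr N') measurable
  have \<phi>_meas: "\<phi> \<in> N \<rightarrow>\<^sub>M N'" unfolding N_def by simp
  have \<phi>: "distr N N' \<phi> = N'"
    unfolding N_def by (subst distr_distr) (auto simp: comp_def assoc_def \<phi>_def distr_id)
  have lift: "distr N S (\<lambda>x. f (\<phi> x)) = distr N' S f" if "f \<in> measurable N' S" for f :: "_ \<Rightarrow> 'z" and S
    using distr_distr[OF that \<phi>_meas] by (simp add: \<phi> comp_def)
  have N'_fst: "distr N' P fst = P" unfolding N'_def by (rule prob_space.distr_pair_fst[OF D])
  have N'_snd: "distr N' D snd = D"
    unfolding N'_def by (intro distr_pair_snd P prob_space_imp_sigma_finite D)
  have pos_MR: "distr MR borel (max 0) = MR" and pos_MW: "distr MW borel (max 0) = MW"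
    using assms by (auto intro!: distr_max_0)
  have N'_fst_meas[measurable]: "fst \<in> N' \<rightarrow>\<^sub>M P" and [measurable]: "snd \<in> N' \<rightarrow>\<^sub>M D" by (simp_all add: N'_def)
  have marg_fst: "distr N S (\<lambda>x. f (fst (\<phi> x))) = distr P S f" if [measurable]: "f \<in> measurable P S" for f :: "_ \<Rightarrow> 'z" and S
    using distr_distr[of f P S fst N'] by (subst lift[of "\<lambda>x. f (fst x)" S]) (simp_all add: N'_fst comp_def)
  have marg_snd: "distr N S (\<lambda>x. f (snd (\<phi> x))) = distr D S f" if [measurable]: "f \<in> measurable D S" for f :: "_ \<Rightarrow> 'z" and S
    using distr_distr[of f D S snd N'] by (subst lift[of "\<lambda>x. f (snd x)" S]) (simp_all add: N'_snd comp_def)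
  define R where "R x = max 0 (fst (fst (\<phi> x)))" for x
  define W where "W x = max 0 (snd (fst (\<phi> x)))" for x
  define U where "U x = fst (snd (\<phi> x))" for x
  define U\<^sub>Y where "U\<^sub>Y x = snd (snd (\<phi> x))" for x
  show ?thesis
  proof (rule that[of N R W U U\<^sub>Y])
    show "prob_space N" by (rule N)
    show "\<forall>\<omega>\<in>space N. 0 \<le> R \<omega>" "\<forall>\<omega>\<in>space N. 0 \<le> W \<omega>" by (auto simp: R_def W_def)
    have "distr N borel R = distr P borel (\<lambda>p. max 0 (fst p))"
      unfolding R_def[abs_def] by (rule marg_fst) measurable
    also have "\<dots> = distr (distr P MR fst) borel (max 0)"
      by (subst distr_distr) (auto simp: P_def comp_def)
    also have "distr P MR fst = MR" unfolding P_def by (rule prob_space.distr_pair_fst[OF MW(1)])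
    finally show "distr N borel R = MR" by (simp add: pos_MR)
    have "distr N borel W = distr P borel (\<lambda>p. max 0 (snd p))"
      unfolding W_def[abs_def] by (rule marg_fst) measurable
    also have "\<dots> = distr (distr P MW snd) borel (max 0)"
      by (subst distr_distr) (auto simp: P_def comp_def)
    also have "distr P MW snd = MW" unfolding P_def by (intro distr_pair_snd MR prob_space_imp_sigma_finite MW)
    finally show "distr N borel W = MW" by (simp add: pos_MW)
    have "distr N borel U = distr D borel fst"
      unfolding U_def[abs_def] by (rule marg_snd) measurable
    also have "\<dots> = distr D ?\<sigma>n fst" by (rule distr_cong) auto
    also have "\<dots> = ?\<sigma>n" unfolding D_def by (rule prob_space.distr_pair_fst[OF prob_space_uniform_sphere])
    finally show "distr N borel U = uniform_sphere" .
    have "distr N borel U\<^sub>Y = distr D borel snd"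
      unfolding U\<^sub>Y_def[abs_def] by (rule marg_snd) measurable
    also have "\<dots> = distr D ?\<sigma>m snd" by (rule distr_cong) auto
    also have "\<dots> = ?\<sigma>m"
      unfolding D_def by (intro distr_pair_snd prob_space_uniform_sphere prob_space_imp_sigma_finite)
    finally show "distr N borel U\<^sub>Y = uniform_sphere" .
    have "indep_rv N' borel (\<lambda>x. max 0 (fst (fst x))) borel (\<lambda>x. fst (snd x))"
      unfolding N'_def by (rule indep_rv_pair_measure[OF P D, where X="\<lambda>p. max 0 (fst p)"]) measurable
    then show "indep_rv N borel R borel U"
      unfolding R_def U_def by (rule indep_rv_measure_preserving[OF N \<phi>_meas \<phi>])
    have "indep_rv N' borel (\<lambda>x. max 0 (fst (fst x)) * max 0 (snd (fst x))) borel (\<lambda>x. snd (snd x))"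
      unfolding N'_def
      by (rule indep_rv_pair_measure[OF P D, where X="\<lambda>p. max 0 (fst p) * max 0 (snd p)"]) measurable
    then show "indep_rv N borel (\<lambda>\<omega>. R \<omega> * W \<omega>) borel U\<^sub>Y"
      unfolding R_def W_def U\<^sub>Y_def by (rule indep_rv_measure_preserving[OF N \<phi>_meas \<phi>])
    have "indep_rv P borel (\<lambda>p. max 0 (fst p)) borel (\<lambda>p. max 0 (snd p))"
      unfolding P_def by (rule indep_rv_pair_measure[OF MR(1) MW(1), where X="max 0" and Y="max 0"]) measurable
    from indep_rv_measure_preserving[OF N' N'_fst_meas N'_fst this]
    have "indep_rv N' borel (\<lambda>x. max 0 (fst (fst x))) borel (\<lambda>x. max 0 (snd (fst x)))" .
    then show "indep_rv N borel R borel W"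
      unfolding R_def W_def by (rule indep_rv_measure_preserving[OF N \<phi>_meas \<phi>])
  qed
qed

text \<open>The existential clause shows that variables as described do exist; the last clause
  covers every choice of them on sample spaces of type \<open>'b\<close>.\<close>

theorem theorem3p1:
  fixes M :: "'a measure" and X :: "'a \<Rightarrow> real^'n"
    and \<mu> :: "real^'n" and \<Sigma> :: "real^'n^'n"
    and a b r :: real
    and B :: "real^'n^'m" and c :: "real^'m"
  assumes "prob_space M"
    and "a > 0" and "b > 0" and "r > 0"
    and "GML M X \<mu> \<Sigma> a b r"
    and "CARD('m) < CARD('n)" and "rank B = CARD('m)"
  shows
    "elliptical M (\<lambda>\<omega>. B *v X \<omega> + c) (B *v \<mu> + c) (B ** \<Sigma> ** transpose B)
       (\<lambda>t. exp (- b * t) * a powr (- (real (CARD('n) - CARD('m)) / 2))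
              * Gamma (real (CARD('n) - CARD('m)) / 2)
              * hurwitz_lerch r (- exp (- a * t)) (real (CARD('n) - CARD('m)) / 2) (b / a))
     \<and> (\<exists>(N :: (real \<times> real \<times> (real^'n) \<times> (real^'m)) measure) R A U W A\<^sub>Y U\<^sub>Y.
           gml_stoch_rep M X \<mu> \<Sigma> a b r A N R U
           \<and> indep_beta_factor N R (real CARD('m) / 2) (real (CARD('n) - CARD('m)) / 2) W
           \<and> stoch_rep M (\<lambda>\<omega>. B *v X \<omega> + c) (B *v \<mu> + c) (B ** \<Sigma> ** transpose B)
                A\<^sub>Y N (\<lambda>\<omega>. R \<omega> * W \<omega>) U\<^sub>Y)
     \<and> (\<forall>(N :: 'b measure) R A U W A\<^sub>Y U\<^sub>Y.
           gml_stoch_rep M X \<mu> \<Sigma> a b r A N R U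
           \<and> indep_beta_factor N R (real CARD('m) / 2) (real (CARD('n) - CARD('m)) / 2) W
           \<and> transpose A\<^sub>Y ** A\<^sub>Y = B ** \<Sigma> ** transpose B
           \<and> distr N borel U\<^sub>Y = uniform_sphere
           \<and> indep_rv N borel (\<lambda>\<omega>. R \<omega> * W \<omega>) borel U\<^sub>Y
           \<longrightarrow> stoch_rep M (\<lambda>\<omega>. B *v X \<omega> + c) (B *v \<mu> + c) (B ** \<Sigma> ** transpose B)
                 A\<^sub>Y N (\<lambda>\<omega>. R \<omega> * W \<omega>) U\<^sub>Y)"
proof (intro conjI allI impI; (elim conjE)?)
  define s where "s = real (CARD('n) - CARD('m)) / 2"
  have s: "0 < s" using assms(6) by (simp add: s_def)
  note M = assms(1) and abr = assms(2-4) and X = assms(5) and less = assms(6) and B = assms(7)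
  show "elliptical M (\<lambda>\<omega>. B *v X \<omega> + c) (B *v \<mu> + c) (B ** \<Sigma> ** transpose B)
       (\<lambda>t. exp (- b * t) * a powr (- (real (CARD('n) - CARD('m)) / 2))
              * Gamma (real (CARD('n) - CARD('m)) / 2)
              * hurwitz_lerch r (- exp (- a * t)) (real (CARD('n) - CARD('m)) / 2) (b / a))"
  proof (rule elliptical_cong[OF GML_marginal[OF M abr X less B]])
    show "0 \<le> exp (- b * 0) * a powr (- (real (CARD('n) - CARD('m)) / 2))
              * Gamma (real (CARD('n) - CARD('m)) / 2)
              * hurwitz_lerch r (- exp (- a * 0)) (real (CARD('n) - CARD('m)) / 2) (b / a)"
      using hurwitz_lerch_minus_one_nonneg[OF abr s] s by (simp add: s_def[symmetric])
  qed (use gml_tail_hurwitz_lerch[OF abr s] in \<open>simp_all add: s_def\<close>)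
  have \<Sigma>: "sym_pos_def \<Sigma>" using X by (simp add: GML_def elliptical_def)
  obtain A :: "real^'n^'n" where A: "transpose A ** A = \<Sigma>" using sym_pos_def_factor[OF \<Sigma>] .
  obtain A\<^sub>Y :: "real^'m^'m" where A\<^sub>Y: "transpose A\<^sub>Y ** A\<^sub>Y = B ** \<Sigma> ** transpose B"
    using sym_pos_def_factor[OF sym_pos_def_congruence[OF \<Sigma> B]] .
  define MR where "MR = density lborel (\<lambda>v. ennreal (gml_radial_density CARD('n) a b r v))"
  define MW where "MW = density lborel (\<lambda>w. ennreal (beta_density (real CARD('m) / 2) s w))"
  have meas: "gml_radial_density CARD('n) a b r \<in> borel_measurable borel" "beta_density (real CARD('m) / 2) s \<in> borel_measurable borel"
    by (simp_all add: gml_radial_density_eq[abs_def] beta_density_eq[abs_def])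
  have AE: "AE v in MR. 0 \<le> v" "AE w in MW. 0 \<le> w"
    unfolding MR_def MW_def using meas
    by (auto simp: AE_density gml_radial_density_def beta_density_def intro!: AE_I2)
  have probs: "prob_space MR" "prob_space MW"
    unfolding MR_def MW_def using abr s
    by (auto intro!: prob_space_gml_radial_density prob_space_beta_density)
  have sets: "sets MR = sets borel" "sets MW = sets borel" by (simp_all add: MR_def MW_def)
  obtain N :: "(real \<times> real \<times> (real^'n) \<times> (real^'m)) measure" and R W
    and U :: "_ \<Rightarrow> real^'n" and U\<^sub>Y :: "_ \<Rightarrow> real^'m"
    where N: "prob_space N" "\<forall>\<omega>\<in>space N. 0 \<le> R \<omega>" "\<forall>\<omega>\<in>space N. 0 \<le> W \<omega>"
      and distrs: "distr N borel R = MR" "distr N borel W = MW"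
      "distr N borel U = uniform_sphere" "distr N borel U\<^sub>Y = uniform_sphere"
      and indep: "indep_rv N borel R borel U" "indep_rv N borel R borel W"
      "indep_rv N borel (\<lambda>\<omega>. R \<omega> * W \<omega>) borel U\<^sub>Y"
    using independent_radial_beta_directions[OF probs(1) sets(1) AE(1) probs(2) sets(2) AE(2)] by blast
  have RW: "distributed N lborel R (\<lambda>v. ennreal (gml_radial_density CARD('n) a b r v))"
    "distributed N lborel W (\<lambda>w. ennreal (beta_density (real CARD('m) / 2) s w))"
    using distrs(1,2) indep(2) meas
    by (auto simp: distributed_def MR_def MW_def indep_rv_def cong: distr_cong)
  have "gml_stoch_rep M X \<mu> \<Sigma> a b r A N R U"
    by (rule GML_stoch_rep[OF M X A N(1,2) RW(1) distrs(3) indep(1)])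
  moreover have W: "indep_beta_factor N R (real CARD('m) / 2) (real (CARD('n) - CARD('m)) / 2) W"
    using N(3) RW(2) indep(2) by (simp add: indep_beta_factor_def s_def)
  moreover note GML_marginal_stoch_rep[OF M abr X less B N(1,2) RW(1) W A\<^sub>Y distrs(4) indep(3)]
  ultimately show "\<exists>(N :: (real \<times> real \<times> (real^'n) \<times> (real^'m)) measure) R A U W A\<^sub>Y U\<^sub>Y.
           gml_stoch_rep M X \<mu> \<Sigma> a b r A N R U
           \<and> indep_beta_factor N R (real CARD('m) / 2) (real (CARD('n) - CARD('m)) / 2) W
           \<and> stoch_rep M (\<lambda>\<omega>. B *v X \<omega> + c) (B *v \<mu> + c) (B ** \<Sigma> ** transpose B)
                A\<^sub>Y N (\<lambda>\<omega>. R \<omega> * W \<omega>) U\<^sub>Y"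
    by blast
next
  fix N :: "'b measure" and R W and A :: "real^'n^'n" and U :: "'b \<Rightarrow> real^'n"
    and A\<^sub>Y :: "real^'m^'m" and U\<^sub>Y :: "'b \<Rightarrow> real^'m"
  assume "gml_stoch_rep M X \<mu> \<Sigma> a b r A N R U"
    and "indep_beta_factor N R (real CARD('m) / 2) (real (CARD('n) - CARD('m)) / 2) W"
    and "transpose A\<^sub>Y ** A\<^sub>Y = B ** \<Sigma> ** transpose B"
    and "distr N borel U\<^sub>Y = uniform_sphere"
    and "indep_rv N borel (\<lambda>\<omega>. R \<omega> * W \<omega>) borel U\<^sub>Y"
  \<comment> \<open>The assumed representation of X supplies the probability space, the sign of
    \<open>R\<close> and its radial density.\<close>
  then show "stoch_rep M (\<lambda>\<omega>. B *v X \<omega> + c) (B *v \<mu> + c) (B ** \<Sigma> ** transpose B)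
                 A\<^sub>Y N (\<lambda>\<omega>. R \<omega> * W \<omega>) U\<^sub>Y"
    using assms by (intro GML_marginal_stoch_rep) (auto simp: gml_stoch_rep_def stoch_rep_def)
qed

end
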